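(* Let $D_{2,2}(N)$ denote the number of $D(2)$-pairs with both elements in $\{1,2,\dots,N\}$ and $D_{2,-2}(N)$ the number of $D(-2)$-pairs with both elements in $\{1,2,\dots,N\}$. Then, as $N\to\infty$, \[ D_{2,2}(N)\sim \frac{L(1,\chi_{8,5})}{\zeta(2)}\, N\approx 0.37888\,N, \qquad D_{2,-2}(N)\sim \frac{L(1,\chi_{8,3})}{\zeta(2)}\, N\approx 0.67524\,N. \]
   Context: For a non-zero integer $q$, a $D(q)$-pair is a set $\{a,b\}$ of two distinct positive integers such that $ab+q$ is a perfect square. $\chi_{8,5}$ is the Dirichlet character modulo $8$ with $\chi_{8,5}(a)=0$ for even $a$, $\chi_{8,5}(a)=1$ if $a\equiv \pm1 \pmod 8$, and $\chi_{8,5}(a)=-1$ if $a\equiv \pm 3\pmod 8$. $\chi_{8,3}$ is the Dirichlet character modulo $8$ with $\chi_{8,3}(a)=0$ for even $a$, $\chi_{8,3}(a)=1$ if $a\equiv 1,3\pmod 8$, and $\chi_{8,3}(a)=-1$ if $a\equiv 5,7 \pmod 8$. For a Dirichlet character $\chi$, $L(s,\chi)=\sum_{n\ge1}\chi(n)n^{-s}$ for $\Re s>1$, and $L(1,\chi)$ denotes the value at $s=1$ of its analytic continuation. $\zeta$ is the Riemann zeta function. *)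

theory Defs
  imports
    "HOL-Complex_Analysis.Complex_Analysis"
    "HOL-Computational_Algebra.Nth_Powers"
    "HOL-Library.Landau_Symbols"
begin

definition D_pair :: "int \<Rightarrow> nat set \<Rightarrow> bool" where
  "D_pair q S \<longleftrightarrow>
     (\<exists>a b. S = {a, b} \<and> a \<noteq> b \<and> 0 < a \<and> 0 < b \<and> is_square (int a * int b + q))"

definition D2_count :: "int \<Rightarrow> nat \<Rightarrow> nat" where
  "D2_count q N = card {S. S \<subseteq> {1..N} \<and> D_pair q S}"

definition chi_8_5 :: "nat \<Rightarrow> complex" where
  "chi_8_5 a = (if even a then 0 else if a mod 8 \<in> {1, 7} then 1 else -1)"

definition chi_8_3 :: "nat \<Rightarrow> complex" where
  "chi_8_3 a = (if even a then 0 else if a mod 8 \<in> {1, 3} then 1 else -1)"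

definition dirichlet_series :: "(nat \<Rightarrow> complex) \<Rightarrow> complex \<Rightarrow> complex" where
  "dirichlet_series f s = (\<Sum>n. f (Suc n) * of_nat (Suc n) powr (-s))"

text \<open>
  The value at \<open>s\<close> of the analytic continuation of the Dirichlet series of a character
  from \<open>Re z > 1\<close> to some half-plane containing \<open>s\<close>. By the identity theorem
  the value does not depend on the half-plane. For a non-principal character the continuation
  is entire, so every \<open>s\<close> is covered; for the principal character only
  \<open>Re s > 1\<close> is, because of the pole at 1.
\<close>

definition dirichlet_L :: "(nat \<Rightarrow> complex) \<Rightarrow> complex \<Rightarrow> complex" where
  "dirichlet_L a s =
     (THE v. \<exists>c f. c < Re s \<and> f holomorphic_on {z. Re z > c} \<and>
        (\<forall>z. Re z > 1 \<longrightarrow> f z = dirichlet_series a z) \<and> v = f s)"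

text \<open>The Riemann zeta function, in its half-plane of convergence \<open>Re s > 1\<close> only.\<close>

definition zeta :: "complex \<Rightarrow> complex" where
  "zeta s = dirichlet_series (\<lambda>_. 1) s"

end

theory Submission
  imports Defs "HOL-Number_Theory.Number_Theory" "HOL-Computational_Algebra.Squarefree"
    "HOL-Real_Asymp.Real_Asymp"
begin

text \<open>
  For \<open>q = \<plusminus>2\<close> and \<open>b > 2\<close>, the map \<open>r \<mapsto> (r\<^sup>2 - q) / b\<close> is a bijection from the square roots of \<open>q\<close>
  modulo \<open>b\<close> in \<open>[0, b)\<close> to the \<open>a < b\<close> for which \<open>{a, b}\<close> is a \<open>D(q)\<close>-pair. So up to a
  bounded error the count is the sum over \<open>b \<le> N\<close> of the number \<open>\<rho>(b)\<close> of square roots modulo \<open>b\<close>.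
  Multiplicativity, Hensel lifting and the supplementary laws of quadratic reciprocity give
  \<open>\<rho> = \<mu>\<^sup>2 * \<chi>\<close> (Dirichlet convolution), hence \<open>\<Sum>b\<le>N. \<rho>(b) = \<Sum>k\<le>N. \<chi>(k) Q(N / k)\<close>, where \<open>Q\<close> counts
  squarefree numbers. As \<open>Q(x) \<sim> x / \<zeta>(2)\<close> is monotone and the partial sums of \<open>\<chi>\<close> are bounded,
  partial summation controls the large \<open>k\<close> and the sum is asymptotic to \<open>N L(1, \<chi>) / \<zeta>(2)\<close>.
  In closed form, \<open>L(1, \<chi>)\<close> is \<open>ln (1 + \<surd>2) / \<surd>2\<close> and \<open>\<pi> / (2\<surd>2)\<close> respectively.
\<close>

section \<open>The density of squarefree numbers\<close>

text \<open>Tannery's theorem, obtained as dominated convergence for the counting measure on the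
  naturals with \<open>h\<close> as majorant.\<close>

lemma tannery:
  fixes f :: "nat \<Rightarrow> nat \<Rightarrow> real"
  assumes h: "summable h" and bound: "\<And>n k. \<bar>f n k\<bar> \<le> h k" and lim: "\<And>k. (\<lambda>n. f n k) \<longlonglongrightarrow> g k"
  shows "(\<lambda>n. \<Sum>k. f n k) \<longlonglongrightarrow> (\<Sum>k. g k)"
proof -
  have h_nonneg: "\<bar>h k\<bar> = h k" for k
    using order_trans[OF abs_ge_zero bound[of 0 k]] by simp
  have inth: "integrable (count_space UNIV) h"
    using h by (simp add: integrable_count_space_nat_iff h_nonneg)
  have intf: "integrable (count_space UNIV) (f n)" for n
    using bound by (intro Bochner_Integration.integrable_bound[OF inth]) (auto simp: h_nonneg)
  have bg: "\<bar>g k\<bar> \<le> h k" for k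
    by (rule tendsto_upperbound[OF tendsto_rabs[OF lim]]) (use bound in auto)
  have intg: "integrable (count_space UNIV) g"
    using bg by (intro Bochner_Integration.integrable_bound[OF inth]) (auto simp: h_nonneg)
  have "(\<lambda>n. integral\<^sup>L (count_space UNIV) (f n)) \<longlonglongrightarrow> integral\<^sup>L (count_space UNIV) g"
    by (rule integral_dominated_convergence[where w = h]) (use inth lim bound in auto)
  then show ?thesis
    by (simp add: integral_count_space_nat intf intg)
qed

lemma filterlim_div_const_nat:
  assumes "d > (0 :: nat)"
  shows "filterlim (\<lambda>n. n div d) at_top at_top"
  unfolding filterlim_at_top
proof
  fix Z :: nat
  show "\<forall>\<^sub>F n in at_top. Z \<le> n div d"
    using eventually_ge_at_top[of "Z * d"]
  proof eventually_elim
    case (elim n)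
    then have "Z * d div d \<le> n div d" by (rule div_le_mono)
    then show ?case using assms by simp
  qed
qed

lemma div_nat_density:
  assumes "d > 0"
  shows "(\<lambda>n. real (n div d) / real n) \<longlonglongrightarrow> 1 / real d"
proof (rule tendsto_sandwich)
  show "(\<lambda>n. 1 / real d - 1 / real n) \<longlonglongrightarrow> 1 / real d"
    using assms by real_asymp
  show "\<forall>\<^sub>F n in sequentially. 1 / real d - 1 / real n \<le> real (n div d) / real n"
    using eventually_gt_at_top[of 0]
  proof eventually_elim
    case (elim n)
    have "real n = real (n div d) * real d + real (n mod d)"
      by (metis div_mult_mod_eq of_nat_add of_nat_mult)
    moreover have "real (n mod d) \<le> real d" using assms by (simp add: less_imp_le)
    ultimately have "real n - real d \<le> real (n div d) * real d" by linarith
    then have "(real n - real d) / (real d * real n) \<le> real (n div d) * real d / (real d * real n)"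
      by (rule divide_right_mono) simp
    also have "\<dots> = real (n div d) / real n" using assms by simp
    also have "(real n - real d) / (real d * real n) = 1 / real d - 1 / real n"
      using elim assms by (simp add: field_simps)
    finally show ?case .
  qed
  show "\<forall>\<^sub>F n in sequentially. real (n div d) / real n \<le> 1 / real d"
    using eventually_gt_at_top[of 0]
  proof eventually_elim
    case (elim n)
    have "real (n div d) \<le> real n / real d" by (rule of_nat_div_le_of_nat)
    with elim show ?case using assms by (simp add: field_simps)
  qed
qed simp

text \<open>Each term divided by \<open>n\<close> tends to \<open>c * w e / e^2\<close>, because
  \<open>n div e^2\<close> is asymptotic to \<open>n / e^2\<close>, and \<open>1 / e^2\<close>
  dominates all of them. The lemma is used twice: with \<open>F\<close> the identity and Moebius
  weights, and with \<open>F\<close> the squarefree count and weights 1.\<close>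

lemma div_square_density:
  fixes F w :: "nat \<Rightarrow> real"
  assumes F_le: "\<And>n. \<bar>F n\<bar> \<le> real n" and F_lim: "(\<lambda>n. F n / real n) \<longlonglongrightarrow> c"
    and w_le: "\<And>e. \<bar>w e\<bar> \<le> 1"
  shows "(\<lambda>n. (\<Sum>e=1..n. w e * F (n div e\<^sup>2)) / real n) \<longlonglongrightarrow> c * (\<Sum>e. w e / (real e)\<^sup>2)"
proof -
  have F0: "F 0 = 0" using F_le[of 0] by simp
  have summ: "summable (\<lambda>e. 1 / (real e)\<^sup>2)"
    using inverse_power_summable[of 2, where ?'a = real] by (simp add: field_simps)
  have summ': "summable (\<lambda>e. w e / (real e)\<^sup>2)"
    by (rule summable_comparison_test'[OF summ, of 0])
       (use w_le in \<open>auto simp: divide_right_mono\<close>)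
  have eq: "(\<Sum>e=1..n. w e * F (n div e\<^sup>2)) / real n = (\<Sum>e. w e * F (n div e\<^sup>2) / real n)" for n
  proof -
    \<comment> \<open>For \<open>e > n\<close> the quotient \<open>n div e^2\<close> is 0; for
      \<open>e = 0\<close> it is 0 by the convention for division by zero. In both cases
      \<open>F 0 = 0\<close>.\<close>
    have "w e * F (n div e\<^sup>2) / real n = 0" if "e \<notin> {1..n}" for e
    proof (cases "e = 0")
      case False
      then have "n < e" using that by auto
      also have "e \<le> e\<^sup>2" by (simp add: power2_eq_square)
      finally show ?thesis by (simp add: F0)
    qed (simp add: F0)
    then show ?thesis
      by (subst suminf_finite[of "{1..n}"]) (auto simp: sum_divide_distrib)
  qed
  have "(\<lambda>n. \<Sum>e. w e * F (n div e\<^sup>2) / real n) \<longlonglongrightarrow> (\<Sum>e. c * (w e / (real e)\<^sup>2))"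
  proof (rule tannery[OF summ])
    fix n e
    have "\<bar>w e * F (n div e\<^sup>2)\<bar> \<le> 1 * real (n div e\<^sup>2)"
      unfolding abs_mult by (intro mult_mono w_le F_le) auto
    also have "\<dots> \<le> real n / (real e)\<^sup>2"
      using of_nat_div_le_of_nat[of n "e\<^sup>2", where ?'a = real] by simp
    finally have "\<bar>w e * F (n div e\<^sup>2)\<bar> / real n \<le> real n / (real e)\<^sup>2 / real n"
      by (intro divide_right_mono) auto
    also have "\<dots> \<le> 1 / (real e)\<^sup>2" by simp
    finally show "\<bar>w e * F (n div e\<^sup>2) / real n\<bar> \<le> 1 / (real e)\<^sup>2" by simp
  next
    fix e
    show "(\<lambda>n. w e * F (n div e\<^sup>2) / real n) \<longlonglongrightarrow> c * (w e / (real e)\<^sup>2)"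
    proof (cases "e = 0")
      case False
      have "filterlim (\<lambda>n. n div e\<^sup>2) sequentially sequentially"
        using False by (intro filterlim_div_const_nat) simp
      from filterlim_compose[OF F_lim this]
      have "(\<lambda>n. w e * (F (n div e\<^sup>2) / real (n div e\<^sup>2) * (real (n div e\<^sup>2) / real n)))
              \<longlonglongrightarrow> w e * (c * (1 / real (e\<^sup>2)))"
        using False by (intro tendsto_intros div_nat_density) auto
      \<comment> \<open>The factor \<open>m\<close> cancels even for \<open>m = 0\<close>, again
        because \<open>F 0 = 0\<close>.\<close>
      moreover have "w e * (F m / real m * (real m / real n)) = w e * F m / real n" for m n
        by (cases "m = 0") (auto simp: F0)
      moreover have "w e * (c * (1 / real (e\<^sup>2))) = c * (w e / (real e)\<^sup>2)" by simp
      ultimately show ?thesis by (simp only:)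
    qed (simp add: F0)
  qed
  then show ?thesis
    unfolding eq by (simp only: suminf_mult[OF summ'])
qed

text \<open>A squarefree multiple of \<open>p\<close> contains \<open>p\<close> exactly once, so the
  squarefree divisors of \<open>n\<close> pair off as \<open>d\<close> and \<open>p * d\<close> with
  \<open>d\<close> prime to \<open>p\<close>. This pairing drives both the cancellation in Moebius
  sums and the induction that evaluates \<open>sqrt_count\<close>.\<close>

lemma sum_squarefree_divisors:
  fixes f :: "nat \<Rightarrow> 'a :: comm_monoid_add"
  assumes p: "prime p" "p dvd n" and n: "n > 0"
  shows "(\<Sum>d | d dvd n \<and> squarefree d. f d) =
         (\<Sum>d | d dvd n \<and> squarefree d \<and> \<not> p dvd d. f d + f (p * d))"
proof -
  let ?S0 = "{d. d dvd n \<and> squarefree d \<and> \<not> p dvd d}"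
  have fin: "finite ?S0" by (rule finite_subset[OF _ finite_divisors_nat[OF n]]) auto
  have "{d. d dvd n \<and> squarefree d} = ?S0 \<union> (*) p ` ?S0"
  proof (intro equalityI subsetI)
    fix d assume d: "d \<in> {d. d dvd n \<and> squarefree d}"
    show "d \<in> ?S0 \<union> (*) p ` ?S0"
    proof (cases "p dvd d")
      case True
      then obtain e where e: "d = p * e" by auto
      have "\<not> p dvd e"
      proof
        assume "p dvd e"
        then have "p\<^sup>2 dvd d" by (simp add: e power2_eq_square)
        then show False using d p(1) by (auto dest: squarefreeD)
      qed
      moreover have "squarefree e" using d squarefree_mono[of e d] by (simp add: e)
      moreover have "e dvd n" using d e by (auto elim: dvd_mult_right)
      ultimately show ?thesis using e by auto
    qed (use d in auto)
  next
    fix d assume "d \<in> ?S0 \<union> (*) p ` ?S0"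
    then show "d \<in> {d. d dvd n \<and> squarefree d}"
    proof
      assume "d \<in> (*) p ` ?S0"
      then obtain e where e: "d = p * e" "e dvd n" "squarefree e" "\<not> p dvd e" by auto
      have cop: "coprime p e" using p(1) e(4) by (rule prime_imp_coprime)
      moreover have "squarefree p" using p(1) by (simp add: squarefree_prime)
      ultimately show ?thesis
        using e p(2) by (auto intro: squarefree_mult_coprime divides_mult)
    qed auto
  qed
  moreover have "?S0 \<inter> (*) p ` ?S0 = {}" by auto
  moreover have "inj_on ((*) p) ?S0" using p(1) by (auto simp: inj_on_def)
  ultimately show ?thesis
    using fin by (simp add: sum.union_disjoint sum.reindex sum.distrib)
qed

section \<open>The Moebius function and the count of squarefree numbers\<close>

definition moebius :: "nat \<Rightarrow> real" where
  "moebius n = (if squarefree n then (- 1) ^ card (prime_factors n) else 0)"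

lemma abs_moebius_le_1: "\<bar>moebius n\<bar> \<le> 1"
  by (simp add: moebius_def power_abs)

text \<open>For \<open>n > 1\<close> and a prime \<open>p\<close> dividing \<open>n\<close>, the
  paired terms for \<open>d\<close> and \<open>p * d\<close> cancel, since \<open>p\<close> adds
  exactly one prime factor.\<close>

lemma sum_moebius_divisors:
  assumes "n > 0"
  shows "(\<Sum>d | d dvd n. moebius d) = of_bool (n = 1)"
proof (cases "n = 1")
  case True
  then show ?thesis by (simp add: moebius_def)
next
  case False
  then obtain p where p: "prime p" "p dvd n" using prime_factor_nat by blast
  have "(\<Sum>d | d dvd n. moebius d) = (\<Sum>d | d dvd n \<and> squarefree d. moebius d)"
    using assms by (intro sum.mono_neutral_right) (auto simp: moebius_def)
  also have "\<dots> = (\<Sum>d | d dvd n \<and> squarefree d \<and> \<not> p dvd d. moebius d + moebius (p * d))"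
    using p assms by (rule sum_squarefree_divisors)
  also have "\<dots> = 0"
  proof (rule sum.neutral, safe)
    fix d assume d: "d dvd n" "squarefree d" "\<not> p dvd d"
    have "coprime p d" using p(1) d(3) by (rule prime_imp_coprime)
    then have "squarefree (p * d)"
      using d p(1) by (intro squarefree_mult_coprime) (auto simp: squarefree_prime)
    moreover have "prime_factors (p * d) = insert p (prime_factors d)"
      using p(1) d assms by (subst prime_factors_product) (auto simp: prime_prime_factors dvd_pos_nat)
    ultimately show "moebius d + moebius (p * d) = 0"
      using d by (auto simp: moebius_def in_prime_factors_iff)
  qed
  finally show ?thesis using False by simp
qed

lemma squarefree_iff_square_part:
  fixes n :: nat
  shows "squarefree n \<longleftrightarrow> square_part n = 1"
  using dvd_square_part_iff[of _ n] squarefreeD[of n "square_part n"]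
  by (auto simp: squarefree_def)

lemma card_multiples:
  assumes "d > 0"
  shows "card {m \<in> {1..n}. d dvd m} = n div (d :: nat)"
proof -
  have "{m \<in> {1..n}. d dvd m} = (*) d ` {1..n div d}"
    using assms by (auto simp: less_eq_div_iff_mult_less_eq mult.commute elim!: dvdE intro!: image_eqI)
  moreover have "inj_on ((*) d) {1..n div d}" using assms by (auto simp: inj_on_def)
  ultimately show ?thesis by (simp add: card_image)
qed

definition squarefree_count :: "nat \<Rightarrow> nat" where
  "squarefree_count n = card {m \<in> {1..n}. squarefree m}"

lemma squarefree_count_le: "squarefree_count n \<le> n"
  unfolding squarefree_count_def by (rule order_trans[OF card_mono[of "{1..n}"]]) auto

lemma squarefree_count_mono: "m \<le> n \<Longrightarrow> squarefree_count m \<le> squarefree_count n"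
  unfolding squarefree_count_def by (rule card_mono) auto

text \<open>Since \<open>e^2 dvd m\<close> means \<open>e dvd square_part m\<close>, the Moebius sum
  over these \<open>e\<close> is the indicator of \<open>square_part m = 1\<close>, that is, of
  \<open>m\<close> being squarefree. Exchanging the sums then counts the multiples of each
  \<open>e^2\<close>.\<close>

lemma squarefree_count_eq_sum_moebius:
  "real (squarefree_count n) = (\<Sum>e=1..n. moebius e * real (n div e\<^sup>2))"
proof -
  have "real (squarefree_count n) = (\<Sum>m=1..n. of_bool (squarefree m))"
    by (simp add: squarefree_count_def of_bool_def sum.If_cases Int_def)
  also have "\<dots> = (\<Sum>m=1..n. \<Sum>e | e \<in> {1..n} \<and> e\<^sup>2 dvd m. moebius e)"
  proof (intro sum.cong refl)
    fix m assume m: "m \<in> {1..n}"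
    have "{e. e \<in> {1..n} \<and> e\<^sup>2 dvd m} = {e. e dvd square_part m}"
    proof (intro equalityI subsetI)
      fix e assume "e \<in> {e. e dvd square_part m}"
      then have e: "e\<^sup>2 dvd m" by (simp add: dvd_square_part_iff)
      then have "e\<^sup>2 \<le> m" "e > 0" using m by (auto intro: dvd_imp_le intro!: gr0I)
      moreover have "e \<le> e\<^sup>2" by (simp add: power2_eq_square)
      ultimately show "e \<in> {e. e \<in> {1..n} \<and> e\<^sup>2 dvd m}" using m e by auto
    qed (auto simp: dvd_square_part_iff)
    moreover have "square_part m > 0" using m square_part_0_iff[of m] by (metis atLeastAtMost_iff gr0I not_one_le_zero)
    ultimately show "of_bool (squarefree m) = (\<Sum>e | e \<in> {1..n} \<and> e\<^sup>2 dvd m. moebius e)"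
      by (simp add: sum_moebius_divisors squarefree_iff_square_part)
  qed
  also have "\<dots> = (\<Sum>e=1..n. \<Sum>m | m \<in> {1..n} \<and> e\<^sup>2 dvd m. moebius e)"
    by (rule sum.swap_restrict) auto
  also have "\<dots> = (\<Sum>e=1..n. moebius e * real (n div e\<^sup>2))"
    by (intro sum.cong refl) (simp add: card_multiples[simplified])
  finally show ?thesis .
qed

text \<open>Every positive \<open>m\<close> is uniquely \<open>s * e^2\<close> with \<open>s\<close>
  squarefree, and the term for \<open>e\<close> counts the admissible \<open>s\<close>. This is the
  inverse relation to the Moebius formula.\<close>

lemma sum_squarefree_count_div_square:
  "(\<Sum>e=1..n. squarefree_count (n div e\<^sup>2)) = n"
proof -
  let ?S = "SIGMA e:{1..n}. {s \<in> {1..n div e\<^sup>2}. squarefree s}"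
  have "bij_betw (\<lambda>(e, s). s * e\<^sup>2) ?S {1..n}"
  proof (rule bij_betwI[where g = "\<lambda>m. (square_part m, squarefree_part m)"])
    show "(\<lambda>(e, s). s * e\<^sup>2) \<in> ?S \<rightarrow> {1..n}"
      by (auto simp: less_eq_div_iff_mult_less_eq)
    show "(\<lambda>m. (square_part m, squarefree_part m)) \<in> {1..n} \<rightarrow> ?S"
    proof
      fix m assume m: "m \<in> {1..n}"
      define e s where "e = square_part m" and "s = squarefree_part m"
      have m_eq: "m = s * e\<^sup>2" unfolding e_def s_def by (rule squarefree_decompose)
      then have "e > 0" "s > 0" using m by (auto intro: gr0I)
      moreover have "e * 1 \<le> e * (e * s)" using \<open>e > 0\<close> \<open>s > 0\<close> by (intro mult_left_mono) auto
      then have "e \<le> m" by (simp add: m_eq power2_eq_square ac_simps)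
      moreover have "squarefree s" by (simp add: s_def squarefree_squarefree_part)
      ultimately show "(square_part m, squarefree_part m) \<in> ?S"
        using m m_eq unfolding e_def[symmetric] s_def[symmetric]
        by (auto simp: less_eq_div_iff_mult_less_eq)
    qed
  next
    fix x assume x: "x \<in> ?S"
    obtain e s where es: "x = (e, s)" by force
    with x have e: "e > 0" and s: "s > 0" "squarefree s" by auto
    define m where "m = s * e\<^sup>2"
    \<comment> \<open>Uniqueness: if the square part of \<open>s * e^2\<close> is
      \<open>e * t\<close>, then \<open>t^2\<close> divides the squarefree \<open>s\<close>, which
      forces \<open>t = 1\<close>.\<close>
    have "e dvd square_part m" by (simp add: dvd_square_part_iff m_def)
    then obtain t where t: "square_part m = e * t" by auto
    have "s * e\<^sup>2 = squarefree_part m * (e * t)\<^sup>2"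
      using squarefree_decompose[of m] t by (simp add: m_def)
    then have s_eq: "s = squarefree_part m * t\<^sup>2"
      using e by (simp add: power_mult_distrib ac_simps)
    then have "t\<^sup>2 dvd s" by simp
    then have "t = 1" using s(2) by (auto dest: squarefreeD)
    then show "(\<lambda>m. (square_part m, squarefree_part m)) (case x of (e, s) \<Rightarrow> s * e\<^sup>2) = x"
      unfolding m_def[symmetric] es prod.case using t s_eq \<open>t = 1\<close> by simp
  next
    fix m assume "m \<in> {1..n}"
    show "(case (square_part m, squarefree_part m) of (e, s) \<Rightarrow> s * e\<^sup>2) = m"
      by (simp add: squarefree_decompose[symmetric])
  qed
  from bij_betw_same_card[OF this] have "card ?S = n" by simp
  then show ?thesis by (simp add: squarefree_count_def)
qed

lemma inverse_squares_nat_sums: "(\<lambda>e. 1 / (real e)\<^sup>2) sums (pi\<^sup>2 / 6)"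
  using inverse_squares_sums sums_Suc_iff[of "\<lambda>e. 1 / (real e)\<^sup>2" "pi\<^sup>2 / 6"] by (simp add: add.commute)

text \<open>The Moebius formula shows that the limit \<open>M\<close> exists. Feeding
  \<open>M\<close> into \<open>div_square_density\<close> a second time, with weights 1, the
  decomposition \<open>m = s * e^2\<close> gives \<open>M * (pi^2 / 6) = 1\<close>, which evaluates
  \<open>M\<close> without an Euler product.\<close>

lemma squarefree_density: "(\<lambda>n. real (squarefree_count n) / real n) \<longlonglongrightarrow> 6 / pi\<^sup>2"
proof -
  define M where "M = (\<Sum>e. moebius e / (real e)\<^sup>2)"
  have one: "(\<lambda>n. real n / real n) \<longlonglongrightarrow> 1"
    by (rule tendsto_eventually, rule eventually_mono[OF eventually_gt_at_top[of 0]]) auto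
  have "(\<lambda>n. (\<Sum>e=1..n. moebius e * real (n div e\<^sup>2)) / real n) \<longlonglongrightarrow> 1 * M"
    unfolding M_def by (rule div_square_density[OF _ one abs_moebius_le_1]) auto
  then have M: "(\<lambda>n. real (squarefree_count n) / real n) \<longlonglongrightarrow> M"
    by (simp add: squarefree_count_eq_sum_moebius)
  have "(\<lambda>n. (\<Sum>e=1..n. 1 * real (squarefree_count (n div e\<^sup>2))) / real n)
          \<longlonglongrightarrow> M * (\<Sum>e. 1 / (real e)\<^sup>2)"
    by (rule div_square_density[OF _ M]) (auto simp: squarefree_count_le)
  also have "(\<lambda>n. (\<Sum>e=1..n. 1 * real (squarefree_count (n div e\<^sup>2))) / real n) = (\<lambda>n. real n / real n)"
    by (simp only: mult_1 of_nat_sum[symmetric] sum_squarefree_count_div_square)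
  also have "(\<Sum>e. 1 / (real e)\<^sup>2) = pi\<^sup>2 / 6"
    by (rule sums_unique[OF inverse_squares_nat_sums, symmetric])
  finally have "M * (pi\<^sup>2 / 6) = 1" using LIMSEQ_unique one by blast
  then have "M = 6 / pi\<^sup>2" by (simp add: field_simps)
  with M show ?thesis by simp
qed

section \<open>Square roots modulo n\<close>

definition sqrt_count :: "int \<Rightarrow> nat \<Rightarrow> nat" where
  "sqrt_count q n = card {x \<in> {0..<int n}. int n dvd x\<^sup>2 - q}"

text \<open>By the Chinese remainder theorem, reduction modulo \<open>m\<close> and modulo
  \<open>n\<close> is a bijection of the solution sets.\<close>

lemma sqrt_count_mult:
  assumes cop: "coprime m n" and pos: "m > 0" "n > 0"
  shows "sqrt_count q (m * n) = sqrt_count q m * sqrt_count q n"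
proof -
  let ?S = "\<lambda>n. {x \<in> {0..<int n}. int n dvd x\<^sup>2 - q}"
  have mod_iff: "int k dvd (x mod int k)\<^sup>2 - q \<longleftrightarrow> int k dvd x\<^sup>2 - q" for k x
    by (simp add: cong_iff_dvd_diff[symmetric] cong_def power_mod)
  have cop': "coprime (int m) (int n)" using cop by simp
  have "bij_betw (\<lambda>x. (x mod int m, x mod int n)) (?S (m * n)) (?S m \<times> ?S n)"
    unfolding bij_betw_def
  proof (intro conjI equalityI subsetI inj_onI)
    fix x y assume xy: "x \<in> ?S (m * n)" "y \<in> ?S (m * n)"
      and "(x mod int m, x mod int n) = (y mod int m, y mod int n)"
    then have "[x = y] (mod int m * int n)"
      using cop' by (intro coprime_cong_mult) (auto simp: cong_def)
    then show "x = y" using xy by (simp add: cong_def)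
  next
    fix z assume "z \<in> (\<lambda>x. (x mod int m, x mod int n)) ` ?S (m * n)"
    then show "z \<in> ?S m \<times> ?S n"
      using pos by (auto simp: mod_iff elim: dvd_mult_left dvd_mult_right)
  next
    fix z assume z: "z \<in> ?S m \<times> ?S n"
    obtain a b where ab: "z = (a, b)" by force
    obtain x where x: "[x = a] (mod int m)" "[x = b] (mod int n)"
      using binary_chinese_remainder_int[OF cop'] by blast
    define y where "y = x mod (int m * int n)"
    have ya: "y mod int m = a" "y mod int n = b"
      using x z ab by (simp_all add: y_def cong_def mod_mod_cancel)
    have "int m dvd y\<^sup>2 - q" "int n dvd y\<^sup>2 - q"
      using z ab mod_iff[of m y] mod_iff[of n y] by (auto simp: ya)
    then have "int m * int n dvd y\<^sup>2 - q" using cop' by (intro divides_mult)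
    moreover have "0 \<le> y" "y < int m * int n" using pos by (auto simp: y_def)
    ultimately show "z \<in> (\<lambda>x. (x mod int m, x mod int n)) ` ?S (m * n)"
      using ab ya by (intro image_eqI[of _ _ y]) auto
  qed
  from bij_betw_same_card[OF this] show ?thesis
    by (simp add: sqrt_count_def card_cartesian_product)
qed

text \<open>Hensel lifting: as \<open>p\<close> divides neither 2 nor \<open>y\<close>, the
  derivative \<open>2 * y\<close> of the polynomial is invertible modulo \<open>p\<close>, and each
  Newton step gains a power of \<open>p\<close>.\<close>

lemma quad_res_lift:
  fixes p q :: int
  assumes p: "prime p" "odd p" "\<not> p dvd q" and res: "QuadRes p q"
  shows "\<exists>y. p ^ Suc k dvd y\<^sup>2 - q"
proof (induction k)
  case 0
  then show ?case using res by (auto simp: QuadRes_def cong_iff_dvd_diff)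
next
  case (Suc k)
  then obtain y t where t: "y\<^sup>2 - q = p ^ Suc k * t" by (auto elim: dvdE)
  have "\<not> p dvd y"
  proof
    assume "p dvd y"
    then have "p dvd y\<^sup>2 - p ^ Suc k * t" by (simp add: power2_eq_square)
    then show False using t p(3) by (simp add: algebra_simps)
  qed
  moreover have "\<not> p dvd 2"
    using p(1,2) primes_dvd_imp_eq[of p 2] by auto
  ultimately have "coprime p (2 * y)"
    using p(1) by (intro prime_imp_coprime) (auto simp: prime_dvd_mult_iff)
  then obtain x where x: "[2 * y * x = 1] (mod p)"
    using cong_solve_coprime_int[of "2 * y" p] by (auto simp: coprime_commute)
  then obtain s where s: "2 * y * x - 1 = p * s" by (auto simp: cong_iff_dvd_diff)
  \<comment> \<open>The Newton step, with \<open>x\<close> standing for the inverse of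
    \<open>2 * y\<close>. The terms of order \<open>p ^ Suc k\<close> cancel up to the error
    \<open>p * s\<close> of this inverse, and the square has the factor
    \<open>p ^ (2 * k + 2)\<close>.\<close>
  have "(y - p ^ Suc k * (t * x))\<^sup>2 - q
      = p ^ Suc k * t - p ^ Suc k * t * (2 * y * x) + (p ^ Suc k * (t * x))\<^sup>2"
    using t by (simp add: power2_eq_square algebra_simps)
  also have "2 * y * x = 1 + p * s" using s by simp
  also have "p ^ Suc k * t - p ^ Suc k * t * (1 + p * s) + (p ^ Suc k * (t * x))\<^sup>2
      = p ^ Suc (Suc k) * (p ^ k * (t * x)\<^sup>2 - t * s)"
    by (simp add: power2_eq_square algebra_simps)
  finally show ?case by (intro exI[of _ "y - p ^ Suc k * (t * x)"]) simp
qed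

text \<open>One root \<open>y\<close> determines all of them. If the prime power divides
  \<open>(x - y) * (x + y)\<close>, then it divides one of the factors, since \<open>p\<close>
  dividing both would divide \<open>2 * x\<close>. So the roots are \<open>y\<close> and
  \<open>- y\<close>, and they differ because \<open>p\<close> does not divide
  \<open>2 * y\<close>.\<close>

lemma sqrt_count_odd_prime_power:
  assumes p: "prime p" "odd p" "\<not> int p dvd q" and k: "k > 0"
  shows "sqrt_count q (p ^ k) = (if QuadRes (int p) q then 2 else 0)"
proof (cases "QuadRes (int p) q")
  case False
  have "\<not> int (p ^ k) dvd x\<^sup>2 - q" for x
  proof
    assume "int (p ^ k) dvd x\<^sup>2 - q"
    then have "int p dvd x\<^sup>2 - q"
      using k by (cases k) (auto elim: dvd_mult_left)
    then show False using False by (auto simp: QuadRes_def cong_iff_dvd_diff)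
  qed
  then show ?thesis using False by (simp add: sqrt_count_def)
next
  case True
  let ?P = "int (p ^ k)"
  have pp: "prime (int p)" using p(1) by simp
  obtain k' where k': "k = Suc k'" using k by (cases k) auto
  obtain y where y: "?P dvd y\<^sup>2 - q"
    using quad_res_lift[OF pp _ p(3) True, of k'] p(2) by (auto simp: k')
  have p_dvd_P: "int p dvd ?P" using k by simp
  have p2: "\<not> int p dvd 2"
    using pp p(2) primes_dvd_imp_eq[of "int p" 2] by auto
  have ndvd: "\<not> int p dvd x" if "?P dvd x\<^sup>2 - q" for x
  proof
    assume "int p dvd x"
    then have "int p dvd x\<^sup>2" by (simp add: power2_eq_square)
    then have "int p dvd x\<^sup>2 - (x\<^sup>2 - q)"
      using dvd_trans[OF p_dvd_P that] by (rule dvd_diff)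
    then show False using p(3) by simp
  qed
  have ndvd2: "\<not> int p dvd 2 * x" if "?P dvd x\<^sup>2 - q" for x
    using ndvd[OF that] p2 pp by (simp add: prime_dvd_mult_iff)
  have Ppos: "?P > 0" using p(1) by (simp add: prime_gt_0_nat)
  have "{x \<in> {0..<?P}. ?P dvd x\<^sup>2 - q} = {y mod ?P, (- y) mod ?P}" (is "?L = ?R")
  proof (intro equalityI subsetI)
    fix x assume x: "x \<in> ?L"
    then have "?P dvd x\<^sup>2 - q" by simp
    then have "?P dvd (x\<^sup>2 - q) - (y\<^sup>2 - q)" using y by (rule dvd_diff)
    also have "(x\<^sup>2 - q) - (y\<^sup>2 - q) = (x - y) * (x + y)"
      by (simp add: power2_eq_square algebra_simps)
    finally have prod: "?P dvd (x - y) * (x + y)" .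
    have "\<not> (int p dvd x - y \<and> int p dvd x + y)"
    proof
      assume "int p dvd x - y \<and> int p dvd x + y"
      then have "int p dvd (x - y) + (x + y)" using dvd_add by blast
      then show False using ndvd2[of x] x by simp
    qed
    then have "coprime ?P (x - y) \<or> coprime ?P (x + y)"
      using pp by (auto simp: prime_imp_coprime)
    then have "?P dvd x - y \<or> ?P dvd x - (- y)"
      using prod by (auto simp: coprime_dvd_mult_left_iff coprime_dvd_mult_right_iff)
    then have "x mod ?P = y mod ?P \<or> x mod ?P = (- y) mod ?P"
      by (simp only: mod_eq_dvd_iff)
    then show "x \<in> ?R" using x by auto
  next
    fix x assume x: "x \<in> ?R"
    then have "x = y mod ?P \<or> x = (- y) mod ?P" by auto
    then have "x\<^sup>2 mod ?P = y\<^sup>2 mod ?P"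
      by (elim disjE) (simp_all only: power_mod power2_minus)
    then have "?P dvd x\<^sup>2 - y\<^sup>2" by (simp only: mod_eq_dvd_iff)
    then have "?P dvd (x\<^sup>2 - y\<^sup>2) + (y\<^sup>2 - q)" using y by (rule dvd_add)
    then have "?P dvd x\<^sup>2 - q" by simp
    moreover have "0 \<le> x" "x < ?P" using x Ppos by auto
    ultimately show "x \<in> ?L" by simp
  qed
  moreover have "y mod ?P \<noteq> (- y) mod ?P"
  proof
    assume "y mod ?P = (- y) mod ?P"
    then have "?P dvd y - (- y)" by (simp only: mod_eq_dvd_iff)
    then have "int p dvd 2 * y" using dvd_trans[OF p_dvd_P] by simp
    then show False using ndvd2[OF y] by simp
  qed
  ultimately show ?thesis using True by (simp add: sqrt_count_def)
qed

text \<open>Squares are 0 or 1 modulo 4, so there is no root from the modulus 4 on; modulo 2 the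
  only root is 0.\<close>

lemma sqrt_count_two_power:
  assumes q: "q mod 4 = 2" and k: "k > 0"
  shows "sqrt_count q (2 ^ k) = (if k = 1 then 1 else 0)"
proof (cases "k = 1")
  case True
  have "even q" using q by presburger
  then have "{x \<in> {0..<2}. 2 dvd x\<^sup>2 - q} = {0}"
    by (auto simp: order_le_less)
  then show ?thesis using True by (simp add: sqrt_count_def)
next
  case False
  have "\<not> int (2 ^ k) dvd x\<^sup>2 - q" for x
  proof
    assume "int (2 ^ k) dvd x\<^sup>2 - q"
    moreover have "(2::int) ^ 2 dvd 2 ^ k" using False k by (intro le_imp_power_dvd) auto
    ultimately have "4 dvd x\<^sup>2 - q" by (auto dest: dvd_trans)
    then have "x\<^sup>2 mod 4 = 2" using q by presburger
    moreover have "x\<^sup>2 mod 4 = 0 \<or> x\<^sup>2 mod 4 = 1"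
    proof (cases "even x")
      case True
      then obtain z where "x = 2 * z" by auto
      then show ?thesis by (simp add: power2_eq_square)
    next
      case False
      then obtain z where "x = 2 * z + 1" by (auto elim: oddE)
      then have "x\<^sup>2 = 1 + (z\<^sup>2 + z) * 4" by (simp add: power2_eq_square algebra_simps)
      then show ?thesis by (simp only: mod_mult_self1) simp
    qed
    ultimately show False by auto
  qed
  then show ?thesis using False by (simp add: sqrt_count_def)
qed

text \<open>Strong induction, splitting off the full power \<open>p ^ k\<close> of a prime divisor.
  On the left this gives a factor by multiplicativity; on the right the pairing of \<open>d\<close>
  with \<open>p * d\<close> gives the factor \<open>chi p ^ k + chi p ^ (k - 1)\<close>, so it
  suffices to compare these local factors.\<close>

lemma sqrt_count_eq_sum_squarefree_divisors:
  fixes chi :: "nat \<Rightarrow> real"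
  assumes mult: "\<And>a b. chi (a * b) = chi a * chi b" and one: "chi 1 = 1" and two: "chi 2 = 0"
    and odd_prime: "\<And>p. prime p \<Longrightarrow> odd p \<Longrightarrow> chi p = (if QuadRes (int p) q then 1 else - 1)"
    and q: "q mod 4 = 2" and cop: "\<And>p. prime p \<Longrightarrow> odd p \<Longrightarrow> \<not> int p dvd q"
    and n: "n > 0"
  shows "real (sqrt_count q n) = (\<Sum>d | d dvd n \<and> squarefree d. chi (n div d))"
  using n
proof (induction n rule: less_induct)
  case (less n)
  have pow: "chi (a ^ k) = chi a ^ k" for a k
    by (induction k) (simp_all add: mult one[simplified])
  show ?case
  proof (cases "n = 1")
    case True
    have "{x \<in> {0..<1::int}. 1 dvd x\<^sup>2 - q} = {0}" by auto
    moreover have "{d. d = (1::nat) \<and> squarefree d} = {1}" by auto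
    ultimately show ?thesis using True one by (simp add: sqrt_count_def)
  next
    case False
    then obtain p where p: "prime p" "p dvd n" using prime_factor_nat by blast
    define k where "k = multiplicity p n"
    obtain m where m: "n = p ^ k * m" "\<not> p dvd m"
      using multiplicity_decompose'[of n p] less.prems p(1) unfolding k_def
      by (metis neq0_conv not_prime_unit)
    have "k > 0" using m p(2) by (cases k) auto
    then obtain k' where k': "k = Suc k'" by (cases k) auto
    have mpos: "m > 0" using m less.prems by (auto intro: gr0I)
    have "1 < p ^ k" using p(1) \<open>k > 0\<close> by (intro one_less_power prime_gt_1_nat)
    then have "m < n" using mpos by (simp add: m(1))
    note IH = less.IH[OF this mpos]
    have cpm: "coprime p m" using p(1) m(2) by (rule prime_imp_coprime)
    have sets: "{d. d dvd n \<and> squarefree d \<and> \<not> p dvd d} = {d. d dvd m \<and> squarefree d}"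
    proof (intro equalityI subsetI)
      fix d assume d: "d \<in> {d. d dvd n \<and> squarefree d \<and> \<not> p dvd d}"
      then have "coprime d (p ^ k)"
        using p(1) prime_imp_coprime[of p d] by (simp add: coprime_commute)
      then show "d \<in> {d. d dvd m \<and> squarefree d}"
        using d by (auto simp: m(1) coprime_dvd_mult_right_iff)
    qed (use m in \<open>auto intro: dvd_trans\<close>)
    have "(\<Sum>d | d dvd n \<and> squarefree d. chi (n div d)) =
        (\<Sum>d | d dvd m \<and> squarefree d. chi (n div d) + chi (n div (p * d)))"
      using sum_squarefree_divisors[OF p less.prems] by (simp only: sets)
    also have "\<dots> = (\<Sum>d | d dvd m \<and> squarefree d. (chi p ^ k + chi p ^ k') * chi (m div d))"
    proof (intro sum.cong refl)
      fix d assume "d \<in> {d. d dvd m \<and> squarefree d}"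
      then obtain e where e: "m = d * e" by auto
      then have "d > 0" using mpos by auto
      have "n div d = p ^ k * e" "n div (p * d) = p ^ k' * e" "m div d = e"
        using \<open>d > 0\<close> prime_gt_0_nat[OF p(1)] by (simp_all add: m(1) e k')
      then show "chi (n div d) + chi (n div (p * d)) = (chi p ^ k + chi p ^ k') * chi (m div d)"
        by (simp add: mult pow algebra_simps)
    qed
    also have "\<dots> = (chi p ^ k + chi p ^ k') * real (sqrt_count q m)"
      by (simp only: IH sum_distrib_left)
    \<comment> \<open>For odd \<open>p\<close> the sum is 2 or 0 according to
      \<open>chi p = 1\<close> or \<open>chi p = - 1\<close>. For \<open>p = 2\<close>, where
      \<open>chi p = 0\<close>, it is \<open>0 ^ k'\<close>, which is 1 exactly if
      \<open>k = 1\<close>.\<close>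
    also have "chi p ^ k + chi p ^ k' = real (sqrt_count q (p ^ k))"
    proof (cases "p = 2")
      case True
      then show ?thesis
        using sqrt_count_two_power[OF q \<open>k > 0\<close>] two by (simp add: k')
    next
      case False
      then have "odd p" using p(1) primes_dvd_imp_eq two_is_prime_nat by blast
      then show ?thesis
        using sqrt_count_odd_prime_power[OF p(1) _ cop[OF p(1)] \<open>k > 0\<close>] odd_prime[OF p(1)]
        by (simp add: k')
    qed
    also have "real (sqrt_count q (p ^ k)) * real (sqrt_count q m) = real (sqrt_count q n)"
      using cpm mpos p(1) sqrt_count_mult[of "p ^ k" m q] by (simp add: m(1) prime_gt_0_nat)
    finally show ?thesis by simp
  qed
qed

section \<open>The supplementary laws for 2 and -2, by Gauss's lemma\<close>

lemma QuadRes_two_iff: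
  assumes p: "prime p" "odd p"
  shows "QuadRes (int p) 2 \<longleftrightarrow> p mod 8 \<in> {1, 7}"
proof -
  obtain h where h: "p = 2 * h + 1" using p(2) by (auto elim: oddE)
  have "p > 2" using p prime_ge_2_nat[of p] by (cases "p = 2") auto
  have ncong: "[2 \<noteq> 0] (mod int p)" using \<open>p > 2\<close> by (auto simp: cong_def)
  interpret GAUSS p 2 using p \<open>p > 2\<close> ncong by unfold_locales auto
  have hp: "int p = 2 * int h + 1" by (simp add: h)
  have A_eq: "A = {0<..int h}" unfolding A_def by (simp add: hp)
  \<comment> \<open>\<open>E\<close> collects the residues of \<open>2 * x\<close>, for
    \<open>1 \<le> x \<le> h\<close>, that exceed \<open>h = (p - 1) / 2\<close>. No reduction
    modulo \<open>p\<close> takes place, so these are the \<open>x\<close> above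
    \<open>h div 2\<close>. The parity of their number decides the symbol.\<close>
  have "E = (\<lambda>x. x * 2) ` {int (h div 2) + 1..int h}"
  proof -
    have "C = (\<lambda>x. x * 2) ` A"
      unfolding C_def B_def image_image by (rule image_cong) (auto simp: A_eq hp)
    then show ?thesis unfolding E_def by (auto simp: A_eq hp)
  qed
  then have "card E = h - h div 2"
    by (simp add: card_image inj_on_def)
  then have "QuadRes (int p) 2 \<longleftrightarrow> even (h - h div 2)"
    using gauss_lemma ncong by (auto simp: Legendre_def minus_one_power_iff split: if_splits)
  also have "\<dots> \<longleftrightarrow> p mod 8 \<in> {1, 7}" unfolding h by simp presburger
  finally show ?thesis .
qed

lemma QuadRes_minus_two_iff:
  assumes p: "prime p" "odd p"
  shows "QuadRes (int p) (- 2) \<longleftrightarrow> p mod 8 \<in> {1, 3}"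
proof -
  obtain h where h: "p = 2 * h + 1" using p(2) by (auto elim: oddE)
  have "p > 2" using p prime_ge_2_nat[of p] by (cases "p = 2") auto
  \<comment> \<open>Gauss's lemma is applied to the positive representative \<open>p - 2\<close> of
    -2.\<close>
  have cong: "[int p - 2 = - 2] (mod int p)" by (simp add: cong_iff_dvd_diff)
  have ncong: "[int p - 2 \<noteq> 0] (mod int p)"
    using zdvd_imp_le[of "int p" 2] \<open>p > 2\<close> by (auto simp: cong_def)
  interpret GAUSS p "int p - 2" using p \<open>p > 2\<close> ncong by unfold_locales auto
  have hp: "int p = 2 * int h + 1" by (simp add: h)
  have A_eq: "A = {0<..int h}" unfolding A_def by (simp add: hp)
  \<comment> \<open>The residue of \<open>x * (p - 2)\<close> is \<open>p - 2 * x\<close>, which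
    exceeds \<open>h\<close> exactly if \<open>2 * x \<le> h\<close>.\<close>
  have "E = (\<lambda>x. int p - 2 * x) ` {1..int (h div 2)}"
  proof -
    have "x * (int p - 2) mod int p = int p - 2 * x" if "x \<in> A" for x
    proof -
      have "x * (int p - 2) = (int p - 2 * x) + (x - 1) * int p" by (simp add: algebra_simps)
      also have "\<dots> mod int p = (int p - 2 * x) mod int p" by (rule mod_mult_self1)
      also have "\<dots> = int p - 2 * x"
        using that by (intro mod_pos_pos_trivial) (auto simp: A_eq hp)
      finally show ?thesis .
    qed
    then have "C = (\<lambda>x. int p - 2 * x) ` A"
      unfolding C_def B_def image_image by (intro image_cong) auto
    then show ?thesis unfolding E_def by (auto simp: A_eq hp)
  qed
  then have "card E = h div 2"
    by (simp add: card_image inj_on_def)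
  then have "QuadRes (int p) (int p - 2) \<longleftrightarrow> even (h div 2)"
    using gauss_lemma ncong by (auto simp: Legendre_def minus_one_power_iff split: if_splits)
  also have "QuadRes (int p) (int p - 2) \<longleftrightarrow> QuadRes (int p) (- 2)"
    unfolding QuadRes_def using cong by (meson cong_sym cong_trans)
  also have "even (h div 2) \<longleftrightarrow> p mod 8 \<in> {1, 3}" unfolding h by simp presburger
  finally show ?thesis .
qed

section \<open>Values of L-functions\<close>

text \<open>Mean value inequality on the segment from \<open>y\<close> to \<open>x\<close>: the
  derivative \<open>- z * w powr (- z - 1)\<close> has a norm that decreases in the real variable
  \<open>w\<close>, so it is largest at \<open>y\<close>.\<close>

lemma norm_powr_diff_le:
  fixes x y :: real and z :: complex
  assumes "0 < y" "y \<le> x" "0 \<le> Re z"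
  shows "norm (of_real x powr (- z) - of_real y powr (- z)) \<le> norm z * y powr (- Re z - 1) * (x - y)"
proof -
  let ?S = "closed_segment (of_real y) (of_real x) :: complex set"
  have seg: "w \<in> \<real> \<and> y \<le> Re w" if "w \<in> ?S" for w
  proof -
    from that obtain u where u: "0 \<le> u" "u \<le> 1" "w = (1 - u) *\<^sub>R of_real y + u *\<^sub>R of_real x"
      unfolding closed_segment_def by blast
    have w: "w = of_real ((1 - u) * y + u * x)" by (simp add: u(3) scaleR_conv_of_real)
    have "0 \<le> u * (x - y)" using u assms by simp
    then show ?thesis by (simp add: w algebra_simps)
  qed
  have "norm (of_real x powr (- z) - of_real y powr (- z)) \<le>
        norm z * y powr (- Re z - 1) * norm (of_real x - of_real y :: complex)"
  proof (rule field_differentiable_bound[where S = ?S and f' = "\<lambda>w. - z * w powr (- z - 1)"])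
    fix w assume w: "w \<in> ?S"
    then have "w \<notin> \<real>\<^sub>\<le>\<^sub>0"
      using seg[OF w] assms by (auto simp: complex_nonpos_Reals_iff)
    then show "((\<lambda>w. w powr (- z)) has_field_derivative - z * w powr (- z - 1)) (at w within ?S)"
      by (rule has_field_derivative_at_within[OF has_field_derivative_powr])
    have "norm (w powr (- z - 1)) = Re w powr (- Re z - 1)"
      using seg[OF w] assms by (subst norm_powr_real_powr) auto
    also have "\<dots> \<le> y powr (- Re z - 1)"
      using seg[OF w] assms by (intro powr_mono2') auto
    finally show "norm (- z * w powr (- z - 1)) \<le> norm z * y powr (- Re z - 1)"
      by (simp add: norm_mult mult_left_mono)
  qed auto
  also have "norm (of_real x - of_real y :: complex) = x - y"
    using assms by (simp flip: of_real_diff)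
  finally show ?thesis .
qed

text \<open>The description in \<open>dirichlet_L\<close> is unique: two continuations agree for
  \<open>Re z\<close> beyond 1 and both abscissas, hence by the identity theorem on the smaller of
  the two half-planes, which contains \<open>s\<close>.\<close>

lemma dirichlet_L_eq:
  assumes "c < Re s" "f holomorphic_on {z. Re z > c}"
    and "\<And>z. Re z > 1 \<Longrightarrow> f z = dirichlet_series a z"
  shows "dirichlet_L a s = f s"
  unfolding dirichlet_L_def
proof (rule the_equality)
  show "\<exists>c f'. c < Re s \<and> f' holomorphic_on {z. c < Re z} \<and>
      (\<forall>z. 1 < Re z \<longrightarrow> f' z = dirichlet_series a z) \<and> f s = f' s"
    using assms by blast
next
  fix v assume "\<exists>c f. c < Re s \<and> f holomorphic_on {z. c < Re z} \<and>
      (\<forall>z. 1 < Re z \<longrightarrow> f z = dirichlet_series a z) \<and> v = f s"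
  then obtain c' g where g: "c' < Re s" "g holomorphic_on {z. c' < Re z}"
    "\<And>z. 1 < Re z \<Longrightarrow> g z = dirichlet_series a z" "v = g s" by blast
  define m where "m = max c c'"
  have "g s = f s"
  proof (rule analytic_continuation_open[of "{z. max 1 m < Re z}" "{z. m < Re z}" g f])
    show "{z. max 1 m < Re z} \<noteq> {}"
      using complex.sel(1)[of "max 1 m + 1" 0] by (metis (mono_tags) empty_iff less_add_one mem_Collect_eq)
    show "open {z. max 1 m < Re z}" "open {z. m < Re z}" by (rule open_halfspace_Re_gt)+
    show "connected {z. m < Re z}" by (intro convex_connected convex_halfspace_Re_gt)
    show "g holomorphic_on {z. m < Re z}" "f holomorphic_on {z. m < Re z}"
      by (rule holomorphic_on_subset[OF g(2)] holomorphic_on_subset[OF assms(2)], force simp: m_def)+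
    show "s \<in> {z. m < Re z}" using assms(1) g(1) by (simp add: m_def)
  qed (auto simp: g assms(3))
  then show "v = f s" using g by simp
qed

text \<open>
  Grouping a Dirichlet series with periodic coefficients of mean zero into blocks of one period
  gains a factor \<open>1 / n\<close>, and so continues it to \<open>Re s > 0\<close>.
\<close>

lemma dirichlet_L_periodic:
  fixes a :: "nat \<Rightarrow> complex"
  assumes N: "N > 0" and periodic: "\<And>n. a (n + N) = a n" and mean: "(\<Sum>n<N. a (Suc n)) = 0"
    and bounded: "\<And>n. norm (a n) \<le> 1" and s: "Re s > 0"
  shows "dirichlet_L a s = (\<Sum>k. \<Sum>n=k*N..<k*N+N. a (Suc n) * of_nat (Suc n) powr (- s))"
proof -
  define g where "g = (\<lambda>k z. \<Sum>n=k*N..<k*N+N. a (Suc n) * of_nat (Suc n) powr (- z))"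
  have shift: "a (n + k * N) = a n" for n k
  proof (induction k)
    case (Suc k)
    have "a (n + Suc k * N) = a ((n + k * N) + N)" by (simp add: ac_simps)
    then show ?case using Suc periodic by simp
  qed simp
  have block_zero: "(\<Sum>n=k*N..<k*N+N. a (Suc n)) = 0" for k
  proof -
    have "(\<Sum>n=k*N..<k*N+N. a (Suc n)) = (\<Sum>n=0..<N. a (Suc (n + k * N)))"
      using sum.shift_bounds_nat_ivl[of "\<lambda>n. a (Suc n)" 0 "k * N" N] by (simp add: add.commute)
    also have "\<dots> = (\<Sum>n<N. a (Suc n))"
      using shift[of "Suc _" k] by (simp add: atLeast0LessThan)
    finally show ?thesis using mean by simp
  qed
  have g_bound: "norm (g k z) \<le> real N ^ 2 * R * real (Suc k) powr (- c - 1)"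
    if c: "c > 0" "Re z \<ge> c" and R: "norm z \<le> R" for k z c R
  proof -
    let ?y = "real (Suc (k * N))"
    \<comment> \<open>The coefficients of a block sum to zero, so the power at its first index
      \<open>?y\<close> can be subtracted from every term. The differences are smaller by one order,
      by \<open>norm_powr_diff_le\<close>.\<close>
    have "g k z = (\<Sum>n=k*N..<k*N+N. a (Suc n) * (of_nat (Suc n) powr (- z) - of_real ?y powr (- z)))"
      by (simp add: g_def right_diff_distrib sum_subtractf block_zero flip: sum_distrib_right)
    also have "norm \<dots> \<le> (\<Sum>n=k*N..<k*N+N. real N * R * real (Suc k) powr (- c - 1))"
    proof (rule sum_norm_le)
      fix n assume n: "n \<in> {k*N..<k*N+N}"
      have [simp]: "0 < 1 + real k * real N" by (simp add: add_pos_nonneg)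
      have y_le: "?y \<le> real (Suc n)" by (simp only: of_nat_le_iff) (use n in simp)
      have "norm (a (Suc n) * (of_nat (Suc n) powr (- z) - of_real ?y powr (- z)))
          \<le> 1 * norm (of_real (real (Suc n)) powr (- z) - of_real ?y powr (- z))"
        unfolding norm_mult by (intro mult_mono) (auto simp: bounded)
      also have "\<dots> \<le> 1 * (norm z * ?y powr (- Re z - 1) * (real (Suc n) - ?y))"
        using c by (intro mult_left_mono norm_powr_diff_le y_le) auto
      also have "\<dots> \<le> 1 * (R * real (Suc k) powr (- c - 1) * real N)"
      proof (intro mult_left_mono mult_mono R)
        have "k * 1 \<le> k * N" using N by (intro mult_left_mono) auto
        then have "?y powr (- Re z - 1) \<le> real (Suc k) powr (- Re z - 1)"
          using c by (intro powr_mono2') (auto simp flip: of_nat_mult)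
        also have "\<dots> \<le> real (Suc k) powr (- c - 1)"
          using c by (intro powr_mono) auto
        finally show "?y powr (- Re z - 1) \<le> real (Suc k) powr (- c - 1)" .
        show "real (Suc n) - ?y \<le> real N" using n by (auto simp flip: of_nat_mult of_nat_add)
        show "0 \<le> real (Suc n) - ?y" using n by (auto simp flip: of_nat_mult)
        show "0 \<le> R" using R norm_ge_zero order_trans by blast
        then show "0 \<le> R * real (Suc k) powr (- c - 1)" by simp
      qed auto
      finally show "norm (a (Suc n) * (of_nat (Suc n) powr (- z) - of_real ?y powr (- z)))
          \<le> real N * R * real (Suc k) powr (- c - 1)" by (simp add: ac_simps)
    qed
    also have "\<dots> = real N ^ 2 * R * real (Suc k) powr (- c - 1)"
      by (simp add: power2_eq_square)
    finally show ?thesis .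
  qed
  have summ: "summable (\<lambda>k. real N ^ 2 * R * real (Suc k) powr (- c - 1))" if "c > 0" for c R
    using that summable_Suc_iff[of "\<lambda>k. real k powr (- c - 1)"]
    by (intro summable_mult) (simp add: summable_real_powr_iff)
  \<comment> \<open>Any abscissa strictly between 0 and \<open>Re s\<close> would do: it makes the
    majorant \<open>k powr (- c - 1)\<close> summable and keeps \<open>s\<close> inside the
    half-plane.\<close>
  define c where "c = Re s / 2"
  have c: "c > 0" "c < Re s" using s by (simp_all add: c_def)
  have "dirichlet_L a s = (\<Sum>k. g k s)"
  proof (rule dirichlet_L_eq[OF c(2)])
    show "(\<lambda>z. \<Sum>k. g k z) holomorphic_on {z. c < Re z}"
    proof (rule holomorphic_uniform_sequence[where f = "\<lambda>n z. \<Sum>k<n. g k z"])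
      show "open {z. c < Re z}" by (rule open_halfspace_Re_gt)
      show "(\<lambda>z. \<Sum>k<n. g k z) holomorphic_on {z. c < Re z}" for n
        unfolding g_def by (intro holomorphic_intros)
      fix x assume x: "x \<in> {z. c < Re z}"
      define d where "d = (Re x - c) / 2"
      have d: "d > 0" using x by (simp add: d_def)
      have Re_ge: "Re z > c" if "z \<in> cball x d" for z
        using that x abs_Re_le_cmod[of "x - z"] by (simp add: d_def dist_norm)
      have norm_le: "norm z \<le> norm x + d" if "z \<in> cball x d" for z
        using that norm_triangle_sub[of z x] by (simp add: dist_norm norm_minus_commute)
      have "uniform_limit (cball x d) (\<lambda>n z. \<Sum>k<n. g k z) (\<lambda>z. \<Sum>k. g k z) sequentially"
      proof (rule Weierstrass_m_test)
        show "norm (g k z) \<le> real N ^ 2 * (norm x + d) * real (Suc k) powr (- c - 1)"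
          if "z \<in> cball x d" for k z
          using c(1) less_imp_le[OF Re_ge[OF that]] norm_le[OF that] by (rule g_bound)
        show "summable (\<lambda>k. real N ^ 2 * (norm x + d) * real (Suc k) powr (- c - 1))"
          using c(1) by (rule summ)
      qed
      then show "\<exists>d>0. cball x d \<subseteq> {z. c < Re z} \<and>
          uniform_limit (cball x d) (\<lambda>n z. \<Sum>k<n. g k z) (\<lambda>z. \<Sum>k. g k z) sequentially"
        using d Re_ge by blast
    qed
  next
    fix z :: complex assume z: "Re z > 1"
    have "summable (\<lambda>n. a (Suc n) * of_nat (Suc n) powr (- z))"
    proof (rule summable_comparison_test')
      show "summable (\<lambda>n. real (Suc n) powr (- Re z))"
        using z summable_Suc_iff[of "\<lambda>n. real n powr (- Re z)"] by (simp add: summable_real_powr_iff)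
      fix n :: nat
      have "norm (of_nat (Suc n) powr (- z)) = real (Suc n) powr (- Re z)"
        by (subst norm_powr_real_powr) auto
      then show "norm (a (Suc n) * of_nat (Suc n) powr (- z)) \<le> real (Suc n) powr (- Re z)"
        using bounded[of "Suc n"] mult_right_mono[of "norm (a (Suc n))" 1 "real (Suc n) powr (- Re z)"]
        by (simp add: norm_mult)
    qed
    then have "(\<lambda>n. a (Suc n) * of_nat (Suc n) powr (- z)) sums dirichlet_series a z"
      unfolding dirichlet_series_def by (rule summable_sums)
    \<comment> \<open>The ungrouped series converges here, so grouping it into blocks leaves its sum
      unchanged.\<close>
    from sums_unique[OF sums_group[OF this N]]
    show "(\<Sum>k. g k z) = dirichlet_series a z" by (simp add: g_def)
  qed
  then show ?thesis by (simp add: g_def)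
qed

section \<open>Closed forms of \<open>zeta 2\<close> and of the two character series\<close>

lemma zeta_2: "zeta 2 = of_real (pi\<^sup>2 / 6)"
proof -
  have "of_nat (Suc n) powr (- 2 :: complex) = of_real (1 / (real n + 1)\<^sup>2)" for n
  proof -
    have "of_nat (Suc n) powr (- 2 :: complex) = inverse (of_nat (Suc n) powr of_nat 2)"
      by (simp add: powr_minus)
    also have "\<dots> = inverse (of_nat (Suc n) ^ 2)"
      using of_nat_neq_0[of n] by (subst powr_complexpow) auto
    also have "\<dots> = inverse (of_real ((real n + 1)\<^sup>2))" by (simp add: add.commute)
    finally show ?thesis by (simp add: inverse_eq_divide)
  qed
  then have "(\<lambda>n. of_nat (Suc n) powr (- 2 :: complex)) sums of_real (pi\<^sup>2 / 6)"
    using sums_of_real[OF inverse_squares_sums, where ?'a = complex] by (simp add: add.commute)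
  then show ?thesis
    unfolding zeta_def dirichlet_series_def by (simp add: sums_unique[symmetric])
qed

text \<open>
  The series is the term-wise integral over \<open>[0, 1]\<close> of
  \<open>(1 + e x\<^sup>2) / (1 + x\<^sup>4) = (\<Sum>k. x ^ (8 * k) * (1 + e x\<^sup>2) * (1 - x\<^sup>4))\<close>.
\<close>

lemma mod_8_series_sums:
  fixes F :: "real \<Rightarrow> real" and e :: real
  assumes F: "\<And>x. 0 \<le> x \<Longrightarrow> x \<le> 1 \<Longrightarrow>
      (F has_real_derivative (1 + e * x\<^sup>2) / (1 + x ^ 4)) (at x)"
    and e: "\<bar>e\<bar> \<le> 1"
  shows "(\<lambda>k. 1 / real (8*k+1) + e / real (8*k+3) - 1 / real (8*k+5) - e / real (8*k+7))
           sums (F 1 - F 0)"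
proof -
  \<comment> \<open>\<open>T k\<close> is the antiderivative of the \<open>k\<close>-th summand that
    vanishes at 0, and \<open>T k 1\<close> is the \<open>k\<close>-th term of the series.\<close>
  define T where "T = (\<lambda>k x. x ^ (8*k+1) / real (8*k+1) + e * (x ^ (8*k+3) / real (8*k+3))
      - x ^ (8*k+5) / real (8*k+5) - e * (x ^ (8*k+7) / real (8*k+7)))"
  have T_deriv: "(T k has_real_derivative x ^ (8*k) * ((1 + e * x\<^sup>2) * (1 - x ^ 4))) (at x)" for k x
  proof -
    have pow: "((\<lambda>x. x ^ m / real m) has_real_derivative x ^ n) (at x)" if "m = Suc n" for m n
      unfolding that by (rule derivative_eq_intros refl | simp)+
    have "(T k has_real_derivative x ^ (8*k) + e * x ^ (8*k+2) - x ^ (8*k+4) - e * x ^ (8*k+6)) (at x)"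
      unfolding T_def by (intro DERIV_add DERIV_diff DERIV_cmult pow) auto
    also have "x ^ (8*k) + e * x ^ (8*k+2) - x ^ (8*k+4) - e * x ^ (8*k+6)
        = x ^ (8*k) * ((1 + e * x\<^sup>2) * (1 - x ^ 4))"
      by (simp add: power_add algebra_simps flip: power_add)
    finally show ?thesis .
  qed
  \<comment> \<open>A finite geometric sum of ratio \<open>x ^ 8\<close>, since
    \<open>(1 - x ^ 4) * (1 + x ^ 4) = 1 - x ^ 8\<close>; the last term is the remainder.\<close>
  have geom: "(\<Sum>k<K. x ^ (8*k) * ((1 + e * x\<^sup>2) * (1 - x ^ 4)))
      = (1 + e * x\<^sup>2) / (1 + x ^ 4) - (1 + e * x\<^sup>2) / (1 + x ^ 4) * x ^ (8*K)" for K and x :: real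
  proof (induction K)
    case (Suc K)
    define c where "c = (1 + e * x\<^sup>2) / (1 + x ^ 4)"
    have nz: "1 + x ^ 4 \<noteq> 0" using zero_le_power_eq[of x 4] by (simp add: add_nonneg_eq_0_iff)
    have c: "(1 + e * x\<^sup>2) * (1 - x ^ 4) = c * (1 - x ^ 8)"
      using nz by (simp add: c_def field_simps flip: power_add)
    have "(\<Sum>k<Suc K. x ^ (8*k) * ((1 + e * x\<^sup>2) * (1 - x ^ 4)))
        = c - c * x ^ (8*K) + x ^ (8*K) * (c * (1 - x ^ 8))"
      unfolding sum.lessThan_Suc Suc unfolding c_def[symmetric] by (simp only: c)
    also have "\<dots> = c - c * x ^ (8 * Suc K)" by (simp add: power_add algebra_simps)
    finally show ?case by (simp only: c_def)
  qed simp
  \<comment> \<open>The remainder is at most \<open>2 * x ^ (8*K)\<close> in absolute value on the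
    unit interval. Comparing its antiderivative \<open>G\<close>, with both signs, to that of the
    bound by monotonicity replaces the estimate of an integral.\<close>
  have bound: "\<bar>F 1 - F 0 - (\<Sum>k<K. T k 1)\<bar> \<le> 2 / real (8*K+1)" for K
  proof -
    define G where "G = (\<lambda>x. F x - (\<Sum>k<K. T k x))"
    define G' where "G' = (\<lambda>x. (1 + e * x\<^sup>2) / (1 + x ^ 4) * x ^ (8*K))"
    have G: "(G has_real_derivative G' x) (at x)" if "0 \<le> x" "x \<le> 1" for x
      unfolding G_def G'_def
      by (rule derivative_eq_intros F T_deriv that refl)+ (simp add: geom)
    have P: "((\<lambda>x. 2 * x ^ (8*K+1) / real (8*K+1)) has_real_derivative 2 * x ^ (8*K)) (at x)" for x
      by (rule derivative_eq_intros refl | simp)+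
    have G'_le: "\<bar>G' x\<bar> \<le> 2 * x ^ (8*K)" if "0 \<le> x" "x \<le> 1" for x
    proof -
      have "\<bar>e * x\<^sup>2\<bar> \<le> 1 * 1"
        unfolding abs_mult using e that by (intro mult_mono) (auto simp: power_le_one)
      then have "\<bar>1 + e * x\<^sup>2\<bar> \<le> 2" by simp
      moreover have "1 \<le> 1 + x ^ 4" by simp
      ultimately have "\<bar>1 + e * x\<^sup>2\<bar> / (1 + x ^ 4) \<le> 2 / 1" by (intro frac_le) auto
      then have "\<bar>1 + e * x\<^sup>2\<bar> / (1 + x ^ 4) * x ^ (8*K) \<le> 2 * x ^ (8*K)"
        using that by (intro mult_right_mono) auto
      moreover have "\<bar>1 + x ^ 4\<bar> = 1 + x ^ 4" by simp
      ultimately show ?thesis using that by (simp add: G'_def abs_mult)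
    qed
    have "G 1 - 2 * 1 ^ (8*K+1) / real (8*K+1) \<le> G 0 - 2 * 0 ^ (8*K+1) / real (8*K+1)"
    proof (rule DERIV_nonpos_imp_nonincreasing[where f = "\<lambda>x. G x - 2 * x ^ (8*K+1) / real (8*K+1)"])
      fix x :: real assume x: "0 \<le> x" "x \<le> 1"
      show "\<exists>y. ((\<lambda>x. G x - 2 * x ^ (8*K+1) / real (8*K+1)) has_real_derivative y) (at x) \<and> y \<le> 0"
        using DERIV_diff[OF G[OF x] P[of x]] G'_le[OF x] by (auto simp: abs_le_iff)
    qed simp
    moreover have "- G 1 - 2 * 1 ^ (8*K+1) / real (8*K+1) \<le> - G 0 - 2 * 0 ^ (8*K+1) / real (8*K+1)"
    proof (rule DERIV_nonpos_imp_nonincreasing[where f = "\<lambda>x. - G x - 2 * x ^ (8*K+1) / real (8*K+1)"])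
      fix x :: real assume x: "0 \<le> x" "x \<le> 1"
      show "\<exists>y. ((\<lambda>x. - G x - 2 * x ^ (8*K+1) / real (8*K+1)) has_real_derivative y) (at x) \<and> y \<le> 0"
        using DERIV_diff[OF DERIV_minus[OF G[OF x]] P[of x]] G'_le[OF x] by (auto simp: abs_le_iff)
    qed simp
    moreover have "G 0 = F 0" by (simp add: G_def T_def power_0_left)
    ultimately show ?thesis by (simp add: G_def)
  qed
  have "(\<lambda>K. (\<Sum>k<K. T k 1) - (F 1 - F 0)) \<longlonglongrightarrow> 0"
  proof (rule Lim_null_comparison)
    show "\<forall>\<^sub>F K in sequentially. norm ((\<Sum>k<K. T k 1) - (F 1 - F 0)) \<le> 2 / real (8*K+1)"
      using bound by (intro always_eventually) (simp add: abs_minus_commute)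
    show "(\<lambda>K. 2 / real (8*K+1)) \<longlonglongrightarrow> 0" by real_asymp
  qed
  then have "(\<lambda>K. \<Sum>k<K. T k 1) \<longlonglongrightarrow> F 1 - F 0" by (simp add: LIM_zero_iff)
  then show ?thesis by (simp add: sums_def T_def)
qed

text \<open>\<open>F\<close> comes from partial fractions over
  \<open>1 + x ^ 4 = (x^2 + sqrt 2 * x + 1) * (x^2 - sqrt 2 * x + 1)\<close>. It vanishes at 0, and
  its value at 1 simplifies because
  \<open>2 + sqrt 2 = (2 - sqrt 2) * (1 + sqrt 2)^2\<close>.\<close>

lemma mod_8_series_minus_sums:
  "(\<lambda>k. 1 / real (8*k+1) + (-1) / real (8*k+3) - 1 / real (8*k+5) - (-1) / real (8*k+7))
     sums (ln (1 + sqrt 2) / sqrt 2)"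
proof -
  define F where "F = (\<lambda>x. (ln (x\<^sup>2 + sqrt 2 * x + 1) - ln (x\<^sup>2 - sqrt 2 * x + 1)) / (2 * sqrt 2))"
  have pos: "x\<^sup>2 + sqrt 2 * x + 1 > 0" "x\<^sup>2 - sqrt 2 * x + 1 > 0" for x :: real
  proof -
    have "x\<^sup>2 + sqrt 2 * x + 1 = (x + sqrt 2 / 2)\<^sup>2 + 1 / 2"
      "x\<^sup>2 - sqrt 2 * x + 1 = (x - sqrt 2 / 2)\<^sup>2 + 1 / 2"
      by (simp_all add: power2_eq_square algebra_simps)
    then show "x\<^sup>2 + sqrt 2 * x + 1 > 0" "x\<^sup>2 - sqrt 2 * x + 1 > 0"
      by (simp_all add: add_nonneg_pos)
  qed
  have "(F has_real_derivative (1 + (-1) * x\<^sup>2) / (1 + x ^ 4)) (at x)" for x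
  proof -
    have prod: "(x\<^sup>2 + sqrt 2 * x + 1) * (x\<^sup>2 - sqrt 2 * x + 1) = 1 + x ^ 4"
      by (simp add: power2_eq_square power4_eq_xxxx algebra_simps)
    have "((\<lambda>x. ln (x\<^sup>2 + sqrt 2 * x + 1)) has_real_derivative
        (2 * x + sqrt 2) / (x\<^sup>2 + sqrt 2 * x + 1)) (at x)"
      "((\<lambda>x. ln (x\<^sup>2 - sqrt 2 * x + 1)) has_real_derivative
        (2 * x - sqrt 2) / (x\<^sup>2 - sqrt 2 * x + 1)) (at x)"
      using pos[of x] by (auto intro!: derivative_eq_intros simp: divide_inverse)
    then have "(F has_real_derivative ((2 * x + sqrt 2) / (x\<^sup>2 + sqrt 2 * x + 1)
        - (2 * x - sqrt 2) / (x\<^sup>2 - sqrt 2 * x + 1)) / (2 * sqrt 2)) (at x)"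
      unfolding F_def by (intro DERIV_cdivide DERIV_diff)
    also have "(2 * x + sqrt 2) / (x\<^sup>2 + sqrt 2 * x + 1) - (2 * x - sqrt 2) / (x\<^sup>2 - sqrt 2 * x + 1)
        = ((2 * x + sqrt 2) * (x\<^sup>2 - sqrt 2 * x + 1) - (2 * x - sqrt 2) * (x\<^sup>2 + sqrt 2 * x + 1))
           / (1 + x ^ 4)"
      using pos[of x] by (simp add: diff_frac_eq flip: prod)
    also have "(2 * x + sqrt 2) * (x\<^sup>2 - sqrt 2 * x + 1) - (2 * x - sqrt 2) * (x\<^sup>2 + sqrt 2 * x + 1)
        = (2 * sqrt 2) * (1 + (-1) * x\<^sup>2)"
      by (simp add: power2_eq_square algebra_simps)
    finally show ?thesis by simp
  qed
  then have "(\<lambda>k. 1 / real (8*k+1) + (-1) / real (8*k+3) - 1 / real (8*k+5) - (-1) / real (8*k+7))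
     sums (F 1 - F 0)" by (intro mod_8_series_sums) auto
  also have "F 1 - F 0 = (ln (2 + sqrt 2) - ln (2 - sqrt 2)) / (2 * sqrt 2)"
    by (simp add: F_def add.commute)
  also have "2 + sqrt 2 = (2 - sqrt 2) * (1 + sqrt 2)\<^sup>2"
    by (simp add: power2_eq_square algebra_simps)
  also have "ln ((2 - sqrt 2) * (1 + sqrt 2)\<^sup>2) = ln (2 - sqrt 2) + 2 * ln (1 + sqrt 2)"
  proof -
    have "0 < 2 - sqrt 2" "0 < 1 + sqrt 2"
      using real_sqrt_less_mono[of 2 4] by (auto intro: add_pos_pos)
    then show ?thesis using ln_mult_pos[of "2 - sqrt 2" "(1 + sqrt 2)\<^sup>2"] ln_realpow[of "1 + sqrt 2" 2]
      by (simp only: zero_less_power of_nat_numeral)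
  qed
  finally show ?thesis by simp
qed

text \<open>The same factorization of \<open>1 + x ^ 4\<close>, whose factors are half of
  \<open>1 + (sqrt 2 * x + 1)^2\<close> and \<open>1 + (sqrt 2 * x - 1)^2\<close>, now yields
  arctangents. They cancel at 0; at 1 their arguments are reciprocal, so they add up to
  \<open>pi / 2\<close>.\<close>

lemma mod_8_series_plus_sums:
  "(\<lambda>k. 1 / real (8*k+1) + 1 / real (8*k+3) - 1 / real (8*k+5) - 1 / real (8*k+7))
     sums (pi / (2 * sqrt 2))"
proof -
  define F where "F = (\<lambda>x. (arctan (sqrt 2 * x + 1) + arctan (sqrt 2 * x - 1)) / sqrt 2)"
  have "(F has_real_derivative (1 + 1 * x\<^sup>2) / (1 + x ^ 4)) (at x)" for x
  proof -
    have "((\<lambda>x. arctan (sqrt 2 * x + 1)) has_real_derivative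
        sqrt 2 / (1 + (sqrt 2 * x + 1)\<^sup>2)) (at x)"
      "((\<lambda>x. arctan (sqrt 2 * x - 1)) has_real_derivative
        sqrt 2 / (1 + (sqrt 2 * x - 1)\<^sup>2)) (at x)"
      by (auto intro!: derivative_eq_intros simp: divide_inverse)
    then have "(F has_real_derivative
        (sqrt 2 / (1 + (sqrt 2 * x + 1)\<^sup>2) + sqrt 2 / (1 + (sqrt 2 * x - 1)\<^sup>2)) / sqrt 2) (at x)"
      unfolding F_def by (intro DERIV_cdivide DERIV_add)
    also have "(sqrt 2 / (1 + (sqrt 2 * x + 1)\<^sup>2) + sqrt 2 / (1 + (sqrt 2 * x - 1)\<^sup>2)) / sqrt 2
        = 1 / (1 + (sqrt 2 * x + 1)\<^sup>2) + 1 / (1 + (sqrt 2 * x - 1)\<^sup>2)"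
      by (simp add: add_divide_distrib)
    also have "\<dots> = ((1 + (sqrt 2 * x - 1)\<^sup>2) + (1 + (sqrt 2 * x + 1)\<^sup>2))
        / ((1 + (sqrt 2 * x + 1)\<^sup>2) * (1 + (sqrt 2 * x - 1)\<^sup>2))"
      by (subst add_frac_eq) (auto simp: sum_power2_eq_zero_iff add_nonneg_eq_0_iff)
    also have "(1 + (sqrt 2 * x + 1)\<^sup>2) * (1 + (sqrt 2 * x - 1)\<^sup>2) = 4 * (1 + x ^ 4)"
      by (simp add: power2_eq_square power4_eq_xxxx algebra_simps)
    also have "(1 + (sqrt 2 * x - 1)\<^sup>2) + (1 + (sqrt 2 * x + 1)\<^sup>2) = 4 * (1 + 1 * x\<^sup>2)"
      by (simp add: power2_eq_square algebra_simps)
    also have "4 * (1 + 1 * x\<^sup>2) / (4 * (1 + x ^ 4)) = (1 + 1 * x\<^sup>2) / (1 + x ^ 4)"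
      by (rule mult_divide_mult_cancel_left) simp
    finally show ?thesis .
  qed
  then have "(\<lambda>k. 1 / real (8*k+1) + 1 / real (8*k+3) - 1 / real (8*k+5) - 1 / real (8*k+7))
     sums (F 1 - F 0)" by (intro mod_8_series_sums) auto
  also have "F 1 - F 0 = (arctan (sqrt 2 + 1) + arctan (sqrt 2 - 1)) / sqrt 2"
    by (simp add: F_def arctan_minus)
  also have "sqrt 2 + 1 = 1 / (sqrt 2 - 1)"
    using real_sqrt_less_mono[of 1 2] by (simp add: field_simps)
  also have "arctan (1 / (sqrt 2 - 1)) = pi / 2 - arctan (sqrt 2 - 1)"
    using arctan_inverse[of "sqrt 2 - 1"] real_sqrt_less_mono[of 1 2] by (simp add: inverse_eq_divide)
  finally show ?thesis by simp
qed

section \<open>Numerical bounds for \<open>sqrt 2\<close> and \<open>ln (1 + sqrt 2)\<close>\<close>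

lemma sqrt_2_bounds: "1.41421356 \<le> sqrt 2" "sqrt 2 \<le> 1.41421357"
  by (rule real_le_rsqrt real_le_lsqrt; simp add: power2_eq_square)+

text \<open>The series \<open>ln x = 2 * artanh ((x - 1) / (x + 1))\<close> at
  \<open>x = 1 + sqrt 2\<close> has the argument \<open>y = sqrt 2 - 1\<close>. With seven terms the
  tail bound is below 0.0000003, enough for the six decimals.\<close>

lemma ln_one_plus_sqrt_2_bounds: "0.881373 < ln (1 + sqrt 2)" "ln (1 + sqrt 2) < 0.881374"
proof -
  define y :: real where "y = sqrt 2 - 1"
  have y_eq: "((1 + sqrt 2) - 1) / ((1 + sqrt 2) + 1) = y"
  proof (subst nonzero_divide_eq_eq)
    have "(1 + sqrt 2) + 1 > (0 :: real)" by (intro add_pos_pos) auto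
    then show "(1 + sqrt 2) + 1 \<noteq> (0 :: real)" by linarith
    show "(1 + sqrt 2) - 1 = y * ((1 + sqrt 2) + 1)" by (simp add: y_def algebra_simps)
  qed
  have "ln (1 + sqrt 2) \<in> {\<Sum>k<7. 2 * y ^ (2*k+1) / real (2*k+1) ..
      (\<Sum>k<7. 2 * y ^ (2*k+1) / real (2*k+1)) + 2 * (y ^ (2*7+1) / (1 - y\<^sup>2) / real (2*7+1))}"
    using ln_approx_bounds[of "1 + sqrt 2" 7] unfolding y_eq by simp
  note ln = this[unfolded atLeastAtMost_iff]
  have lo: "0.41421356 ^ n \<le> y ^ n" and hi: "y ^ n \<le> 0.41421357 ^ n" for n
    using sqrt_2_bounds by (auto simp: y_def intro!: power_mono)
  have "(0.881373::real) < (\<Sum>k<7. 2 * 0.41421356 ^ (2*k+1) / real (2*k+1))"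
    by (simp add: eval_nat_numeral)
  also have "\<dots> \<le> (\<Sum>k<7. 2 * y ^ (2*k+1) / real (2*k+1))"
    by (intro sum_mono divide_right_mono mult_left_mono lo) auto
  finally show "0.881373 < ln (1 + sqrt 2)" using ln by linarith
  have "(\<Sum>k<7. 2 * y ^ (2*k+1) / real (2*k+1)) \<le> (\<Sum>k<7. 2 * 0.41421357 ^ (2*k+1) / real (2*k+1))"
    by (intro sum_mono divide_right_mono mult_left_mono hi) auto
  moreover have "y ^ (2*7+1) / (1 - y\<^sup>2) / real (2*7+1) \<le>
      0.41421357 ^ (2*7+1) / (1 - 0.41421357\<^sup>2) / real (2*7+1)"
    using hi[of 2] sqrt_2_bounds by (intro divide_right_mono frac_le hi) (auto simp: power2_eq_square y_def)
  moreover have "(\<Sum>k<7. 2 * 0.41421357 ^ (2*k+1) / real (2*k+1)) +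
      2 * (0.41421357 ^ (2*7+1) / (1 - 0.41421357\<^sup>2) / real (2*7+1)) < (0.881374::real)"
    by (simp add: eval_nat_numeral)
  ultimately show "ln (1 + sqrt 2) < 0.881374" using ln by linarith
qed

section \<open>Counting pairs\<close>

text \<open>Summation by parts: the differences of \<open>g\<close> are nonnegative and telescope,
  so they contribute at most \<open>C * (g 0 - g n)\<close>, and the boundary term at most
  \<open>C * g n\<close>.\<close>

lemma abs_sum_mult_antimono_le:
  fixes f g :: "nat \<Rightarrow> real"
  assumes anti: "\<And>i j. i \<le> j \<Longrightarrow> g j \<le> g i" and nonneg: "\<And>i. 0 \<le> g i"
    and bound: "\<And>n. \<bar>\<Sum>i<n. f i\<bar> \<le> C"
  shows "\<bar>\<Sum>i<n. f i * g i\<bar> \<le> C * g 0"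
proof -
  define S where "S = (\<lambda>n. \<Sum>i<n. f i)"
  have parts: "(\<Sum>i<n. f i * g i) = S n * g n + (\<Sum>i<n. S (Suc i) * (g i - g (Suc i)))" for n
    by (induction n) (simp_all add: S_def algebra_simps)
  have S_le: "\<bar>S n\<bar> \<le> C" for n unfolding S_def by (rule bound)
  have C: "0 \<le> C" using bound[of 0] by simp
  have "\<bar>\<Sum>i<n. S (Suc i) * (g i - g (Suc i))\<bar> \<le> (\<Sum>i<n. C * (g i - g (Suc i)))"
    using anti C
    by (intro sum_abs[THEN order_trans] sum_mono) (auto simp: abs_mult intro!: mult_mono S_le)
  also have "\<dots> = C * (g 0 - g n)"
    by (simp add: sum_lessThan_telescope' flip: sum_distrib_left)
  finally have "\<bar>\<Sum>i<n. S (Suc i) * (g i - g (Suc i))\<bar> \<le> C * (g 0 - g n)" .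
  moreover have "\<bar>S n * g n\<bar> \<le> C * g n"
    using nonneg by (auto simp: abs_mult intro: mult_right_mono S_le)
  ultimately show ?thesis unfolding parts by (simp add: algebra_simps)
qed

text \<open>Write \<open>n = k * d\<close> and sum over the cofactor \<open>k\<close> first: for
  fixed \<open>k\<close>, the variable \<open>d\<close> runs over the squarefree numbers up to
  \<open>N div k\<close>.\<close>

lemma sum_squarefree_divisor_convolution:
  fixes f :: "nat \<Rightarrow> real"
  shows "(\<Sum>n=1..N. \<Sum>d | d dvd n \<and> squarefree d. f (n div d)) =
         (\<Sum>k=1..N. f k * real (squarefree_count (N div k)))"
proof -
  have "(\<Sum>n=1..N. \<Sum>d | d dvd n \<and> squarefree d. f (n div d)) =
      (\<Sum>(n, d) \<in> (SIGMA n:{1..N}. {d. d dvd n \<and> squarefree d}). f (n div d))"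
    by (intro sum.Sigma) (auto intro: finite_subset[OF _ finite_divisors_nat])
  also have "\<dots> = (\<Sum>(k, d) \<in> (SIGMA k:{1..N}. {d \<in> {1..N div k}. squarefree d}). f k)"
  proof (rule sum.reindex_bij_witness[where i = "\<lambda>(k, d). (k * d, d)" and j = "\<lambda>(n, d). (n div d, d)"], goal_cases)
    case (2 a)
    then obtain n d k where a: "a = (n, d)" "n = d * k" "n \<in> {1..N}" "squarefree d" by auto
    then have "d > 0" "k > 0" by (auto intro: gr0I)
    moreover have "k \<le> d * k" using \<open>d > 0\<close> by simp
    then have "k \<le> N" by (rule order_trans) (use a in simp)
    ultimately show ?case using a by (auto simp: less_eq_div_iff_mult_less_eq mult.commute)
  next
    case (4 b)
    then show ?case by (auto simp: less_eq_div_iff_mult_less_eq mult.commute)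
  qed auto
  also have "\<dots> = (\<Sum>k=1..N. f k * real (squarefree_count (N div k)))"
    by (subst sum.Sigma[symmetric]) (auto simp: squarefree_count_def mult.commute)
  finally show ?thesis .
qed

text \<open>The terms beyond \<open>m\<close> contribute at most \<open>C * N / (m + 1)\<close>
  uniformly in \<open>N\<close>, so \<open>m\<close> can be fixed before \<open>N\<close> tends to
  infinity. For a fixed \<open>m\<close> the density of squarefree numbers applies term by term. The
  sequence \<open>s\<close> allows convergence to be known only along certain truncation
  points.\<close>

lemma twisted_squarefree_density:
  fixes f :: "nat \<Rightarrow> real"
  assumes bound: "\<And>m n. \<bar>\<Sum>k=m..<n. f k\<bar> \<le> C"
    and s: "filterlim s sequentially sequentially" and L: "(\<lambda>n. \<Sum>k=1..s n. f k / real k) \<longlonglongrightarrow> L"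
  shows "(\<lambda>N. (\<Sum>k=1..N. f k * real (squarefree_count (N div k))) / real N) \<longlonglongrightarrow> 6 / pi\<^sup>2 * L"
proof -
  define Q where "Q = (\<lambda>n. real (squarefree_count n))"
  define M where "M = 6 / pi\<^sup>2"
  have C: "0 \<le> C" using bound[of 0 0] by simp
  have tail: "\<bar>\<Sum>k=Suc m..N. f k * Q (N div k)\<bar> \<le> C * (real N / real (Suc m))" for m N
  proof -
    have "(\<Sum>k=Suc m..N. f k * Q (N div k)) = (\<Sum>i<N - m. f (Suc m + i) * Q (N div (Suc m + i)))"
      by (rule sum.reindex_bij_witness[of _ "\<lambda>i. Suc m + i" "\<lambda>k. k - Suc m"]) auto
    also have "\<bar>\<dots>\<bar> \<le> C * Q (N div (Suc m + 0))"
    proof (rule abs_sum_mult_antimono_le)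
      show "Q (N div (Suc m + j)) \<le> Q (N div (Suc m + i))" if "i \<le> j" for i j
        using that by (auto simp: Q_def intro!: squarefree_count_mono div_le_mono2)
      show "\<bar>\<Sum>i<n. f (Suc m + i)\<bar> \<le> C" for n
        using bound[of "Suc m" "Suc m + n"] sum.atLeastLessThan_shift_0[of f "Suc m" "Suc m + n"]
        by (simp add: atLeast0LessThan)
    qed (simp add: Q_def)
    also have "\<dots> \<le> C * real (N div Suc m)"
      using C by (intro mult_left_mono) (simp_all add: Q_def squarefree_count_le)
    also have "\<dots> \<le> C * (real N / real (Suc m))"
      using C by (intro mult_left_mono of_nat_div_le_of_nat)
    finally show ?thesis .
  qed
  have main: "(\<lambda>N. (\<Sum>k=1..m. f k * Q (N div k)) / real N) \<longlonglongrightarrow> M * (\<Sum>k=1..m. f k / real k)" for m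
  proof -
    have "(\<lambda>N. Q (N div k) / real N) \<longlonglongrightarrow> M * (1 / real k)" if k: "k > 0" for k
    proof -
      have "filterlim (\<lambda>n. n div k) sequentially sequentially"
        by (rule filterlim_div_const_nat[OF k])
      from filterlim_compose[OF squarefree_density this]
      have "(\<lambda>n. Q (n div k) / real (n div k) * (real (n div k) / real n)) \<longlonglongrightarrow> M * (1 / real k)"
        using k unfolding Q_def M_def by (intro tendsto_mult div_nat_density) auto
      moreover have "Q (n div k) / real (n div k) * (real (n div k) / real n) = Q (n div k) / real n" for n
        by (cases "n div k = 0") (auto simp: Q_def squarefree_count_def)
      ultimately show ?thesis by (simp only:)
    qed
    then have "(\<lambda>N. \<Sum>k=1..m. f k * (Q (N div k) / real N)) \<longlonglongrightarrow> (\<Sum>k=1..m. f k * (M * (1 / real k)))"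
      by (intro tendsto_intros) auto
    then show ?thesis by (simp add: sum_divide_distrib sum_distrib_left ac_simps)
  qed
  have "(\<lambda>N. (\<Sum>k=1..N. f k * Q (N div k)) / real N) \<longlonglongrightarrow> M * L"
  proof (rule LIMSEQ_I)
    fix r :: real assume r: "r > 0"
    \<comment> \<open>The truncation point \<open>m\<close> is taken from the range of
      \<open>s\<close>, far enough out that the error of the truncated series and the tail bound
      together stay below \<open>r / 2\<close>.\<close>
    have "(\<lambda>j. \<bar>M * (\<Sum>k=1..s j. f k / real k) - M * L\<bar> + C / real (Suc (s j)))
        \<longlonglongrightarrow> \<bar>M * L - M * L\<bar> + 0"
      by (intro tendsto_intros L filterlim_compose[OF LIMSEQ_Suc[OF lim_const_over_n] s])
    then have "\<forall>\<^sub>F j in sequentially.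
        \<bar>M * (\<Sum>k=1..s j. f k / real k) - M * L\<bar> + C / real (Suc (s j)) < r / 2"
      using r by (intro order_tendstoD) auto
    then obtain m where m: "\<bar>M * (\<Sum>k=1..m. f k / real k) - M * L\<bar> + C / real (Suc m) < r / 2"
      using eventually_happens trivial_limit_sequentially by blast
    have "\<forall>\<^sub>F N in sequentially.
        \<bar>(\<Sum>k=1..m. f k * Q (N div k)) / real N - M * (\<Sum>k=1..m. f k / real k)\<bar> < r / 2"
      using main[of m, THEN tendstoD, of "r / 2"] r by (simp add: dist_real_def)
    moreover have "\<forall>\<^sub>F N in sequentially. N > m" by (rule eventually_gt_at_top)
    ultimately have "\<forall>\<^sub>F N in sequentially. norm ((\<Sum>k=1..N. f k * Q (N div k)) / real N - M * L) < r"
    proof eventually_elim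
      case (elim N)
      have split: "(\<Sum>k=1..N. f k * Q (N div k)) = (\<Sum>k=1..m. f k * Q (N div k)) + (\<Sum>k=Suc m..N. f k * Q (N div k))"
      proof -
        have "{1..N} = {1..m} \<union> {Suc m..N}" using elim by auto
        then show ?thesis by (simp only:) (rule sum.union_disjoint, auto)
      qed
      have "\<bar>(\<Sum>k=Suc m..N. f k * Q (N div k)) / real N\<bar> \<le> C * (real N / real (Suc m)) / real N"
        using tail[where m = m and N = N] by (simp only: abs_divide abs_of_nat) (rule divide_right_mono, auto)
      also have "\<dots> = C / real (Suc m)" using elim by simp
      finally show ?case using elim(1) m unfolding split add_divide_distrib real_norm_def by linarith
    qed
    then show "\<exists>no. \<forall>N\<ge>no. norm ((\<Sum>k=1..N. f k * Q (N div k)) / real N - M * L) < r"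
      by (simp add: eventually_sequentially)
  qed
  then show ?thesis by (simp add: Q_def M_def)
qed

text \<open>The square root in \<open>[0, b)\<close> belonging to a partner \<open>a\<close> is the
  nonnegative root of \<open>a * b + q\<close>. The assumption \<open>b > 2\<close> ensures that
  \<open>q\<close> is too small to push \<open>a\<close> or the root out of range.\<close>

lemma card_square_partners:
  fixes q :: int
  assumes q: "\<bar>q\<bar> = 2" and b: "b > 2"
  shows "card {a \<in> {1..<b}. is_square (int a * int b + q)} = sqrt_count q b"
proof -
  let ?A = "{a \<in> {1..<b}. is_square (int a * int b + q)}" and ?R = "{x \<in> {0..<int b}. int b dvd x\<^sup>2 - q}"
  have "bij_betw (\<lambda>x. nat ((x\<^sup>2 - q) div int b)) ?R ?A"
    unfolding bij_betw_def
  proof (intro conjI inj_onI equalityI subsetI)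
    have quot: "\<exists>a. x\<^sup>2 - q = int a * int b \<and> nat ((x\<^sup>2 - q) div int b) = a \<and> 1 \<le> a \<and> a < b"
      if x: "x \<in> ?R" for x
    proof -
      from x obtain a where a: "x\<^sup>2 - q = int b * a" by auto
      have bounds: "0 \<le> x" "x \<le> int b - 1" using x by auto
      have "x\<^sup>2 \<le> (int b - 1)\<^sup>2" using bounds by (intro power_mono) auto
      also have "\<dots> = int b * int b - 2 * int b + 1" by (simp add: power2_eq_square algebra_simps)
      also have "\<dots> < int b * int b + q" using q b by linarith
      finally have "int b * a < int b * int b" using a by simp
      then have "a < int b" using b by simp
      moreover have "0 < x\<^sup>2 - q"
      proof (rule ccontr)
        assume "\<not> 0 < x\<^sup>2 - q"
        then have le: "x\<^sup>2 \<le> q" by simp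
        have "0 \<le> x\<^sup>2" by simp
        have "q = 2" using q le \<open>0 \<le> x\<^sup>2\<close> by linarith
        have "x < 2"
        proof (rule ccontr)
          assume "\<not> x < 2"
          then have "2\<^sup>2 \<le> x\<^sup>2" by (intro power_mono) auto
          then show False using le \<open>q = 2\<close> by simp
        qed
        then have "x = 0 \<or> x = 1" using bounds by auto
        \<comment> \<open>For \<open>q = 2\<close> a nonpositive \<open>x^2 - q\<close> is -2 or -1,
          which no \<open>b > 2\<close> divides.\<close>
        then have "int b dvd 2 \<or> int b dvd 1"
          using x \<open>q = 2\<close> by auto
        then show False using b zdvd_imp_le[of "int b" 2] zdvd_imp_le[of "int b" 1] by auto
      qed
      then have "0 < a" using a b by (simp add: zero_less_mult_iff)
      ultimately show ?thesis
        using a b by (intro exI[of _ "nat a"]) (auto simp: mult.commute)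
    qed
    {
      fix x assume "x \<in> (\<lambda>x. nat ((x\<^sup>2 - q) div int b)) ` ?R"
      then obtain y where y: "y \<in> ?R" "x = nat ((y\<^sup>2 - q) div int b)" by auto
      from quot[OF y(1)] have "int x * int b + q = y\<^sup>2" "1 \<le> x" "x < b" using y(2) by auto
      then show "x \<in> ?A" by auto
    next
      fix x y assume xy: "x \<in> ?R" "y \<in> ?R" "nat ((x\<^sup>2 - q) div int b) = nat ((y\<^sup>2 - q) div int b)"
      have "x\<^sup>2 = y\<^sup>2" using quot[OF xy(1)] quot[OF xy(2)] xy(3) by auto
      then show "x = y" using xy(1,2) by (auto simp: power2_eq_iff)
    next
      fix a assume a: "a \<in> ?A"
      then obtain r where "int a * int b + q = r\<^sup>2" by (auto elim: is_nth_powerE)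
      then have r: "int a * int b + q = \<bar>r\<bar>\<^sup>2" by simp
      have "int a * int b \<le> (int b - 1) * int b" using a by (intro mult_right_mono) auto
      also have "\<dots> = int b * int b - int b" by (simp add: algebra_simps)
      \<comment> \<open>From \<open>a \<le> b - 1\<close> the square is at most
        \<open>b^2 - b + q\<close>, and \<open>q \<le> 2 < b\<close>.\<close>
      finally have "\<bar>r\<bar>\<^sup>2 < int b * int b" using r q b by linarith
      also have "int b * int b = (int b)\<^sup>2" by (simp only: power2_eq_square)
      finally have "\<bar>r\<bar> < int b" by (rule power2_less_imp_less) simp
      moreover have diff: "\<bar>r\<bar>\<^sup>2 - q = int a * int b" by (simp only: r[symmetric] add_diff_cancel_right')
      moreover have "int b dvd \<bar>r\<bar>\<^sup>2 - q" unfolding diff by simp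
      ultimately have "\<bar>r\<bar> \<in> ?R" by auto
      moreover have "a = nat ((\<bar>r\<bar>\<^sup>2 - q) div int b)" unfolding diff using b by simp
      ultimately show "a \<in> (\<lambda>x. nat ((x\<^sup>2 - q) div int b)) ` ?R" by (rule rev_image_eqI)
    }
  qed
  from bij_betw_same_card[OF this] show ?thesis by (simp add: sqrt_count_def)
qed

text \<open>Indexing each unordered pair by its larger element \<open>b\<close> counts it exactly
  once.\<close>

lemma D2_count_eq:
  "D2_count q N = (\<Sum>b=1..N. card {a \<in> {1..<b}. is_square (int a * int b + q)})"
proof -
  let ?T = "SIGMA b:{1..N}. {a \<in> {1..<b}. is_square (int a * int b + q)}"
  have "{S. S \<subseteq> {1..N} \<and> D_pair q S} = (\<lambda>(b, a). {a, b}) ` ?T"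
  proof (intro equalityI subsetI)
    fix S assume "S \<in> {S. S \<subseteq> {1..N} \<and> D_pair q S}"
    then obtain a b where ab: "S = {a, b}" "S \<subseteq> {1..N}" "a \<noteq> b" "is_square (int a * int b + q)"
      by (auto simp: D_pair_def)
    show "S \<in> (\<lambda>(b, a). {a, b}) ` ?T"
    proof (cases "a < b")
      case True
      then show ?thesis using ab by (intro image_eqI[of _ _ "(b, a)"]) auto
    next
      case False
      then show ?thesis using ab by (intro image_eqI[of _ _ "(a, b)"]) (auto simp: mult.commute)
    qed
  next
    fix S assume "S \<in> (\<lambda>(b, a). {a, b}) ` ?T"
    then obtain a b where ab: "S = {a, b}" "b \<le> N" "1 \<le> a" "a < b" "is_square (int a * int b + q)"
      by auto
    then have "D_pair q S" unfolding D_pair_def by (intro exI[of _ a] exI[of _ b]) auto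
    then show "S \<in> {S. S \<subseteq> {1..N} \<and> D_pair q S}" using ab by auto
  qed
  moreover have "inj_on (\<lambda>(b, a). {a, b}) ?T" by (auto simp: inj_on_def doubleton_eq_iff)
  ultimately show ?thesis
    by (simp add: D2_count_def card_image)
qed

text \<open>Only \<open>b = 1\<close> and \<open>b = 2\<close> escape
  \<open>card_square_partners\<close>. There both counts lie between 0 and \<open>b\<close>, so each
  contributes an error of at most 2.\<close>

lemma D2_count_approx:
  fixes q :: int
  assumes q: "\<bar>q\<bar> = 2"
  shows "\<bar>real (D2_count q N) - (\<Sum>b=1..N. real (sqrt_count q b))\<bar> \<le> 4"
proof -
  let ?A = "\<lambda>b. card {a \<in> {1..<b}. is_square (int a * int b + q)}"
  have le: "?A b \<le> b" "sqrt_count q b \<le> b" for b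
  proof -
    have "?A b \<le> card {1..<b}" by (rule card_mono) auto
    then show "?A b \<le> b" by simp
    have "sqrt_count q b \<le> card {0..<int b}" unfolding sqrt_count_def by (rule card_mono) auto
    then show "sqrt_count q b \<le> b" by simp
  qed
  have "\<bar>real (D2_count q N) - (\<Sum>b=1..N. real (sqrt_count q b))\<bar>
      = \<bar>\<Sum>b=1..N. real (?A b) - real (sqrt_count q b)\<bar>"
    by (simp add: D2_count_eq sum_subtractf)
  also have "\<dots> \<le> (\<Sum>b=1..N. \<bar>real (?A b) - real (sqrt_count q b)\<bar>)" by (rule sum_abs)
  also have "\<dots> = (\<Sum>b\<in>{1..N} \<inter> {1, 2}. \<bar>real (?A b) - real (sqrt_count q b)\<bar>)"
  proof (rule sum.mono_neutral_right)
    show "\<forall>b\<in>{1..N} - {1..N} \<inter> {1, 2}. \<bar>real (?A b) - real (sqrt_count q b)\<bar> = 0"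
    proof
      fix b assume "b \<in> {1..N} - {1..N} \<inter> {1, 2}"
      then have "b > 2" by auto
      then show "\<bar>real (?A b) - real (sqrt_count q b)\<bar> = 0"
        by (simp only: card_square_partners[OF q])
    qed
  qed auto
  also have "\<dots> \<le> (\<Sum>b\<in>{1..N} \<inter> {1, 2}. 2)"
  proof (rule sum_mono)
    fix b assume "b \<in> {1..N} \<inter> {1, 2}"
    then show "\<bar>real (?A b) - real (sqrt_count q b)\<bar> \<le> 2" using le[of b] by auto
  qed
  also have "\<dots> \<le> (\<Sum>b\<in>{1, 2::nat}. 2)" by (rule sum_mono2) auto
  finally show ?thesis by simp
qed

lemma D2_count_density:
  fixes f :: "nat \<Rightarrow> real"
  assumes q: "\<bar>q\<bar> = 2"
    and mult: "\<And>a b. f (a * b) = f a * f b" and one: "f 1 = 1" and two: "f 2 = 0"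
    and odd_prime: "\<And>p. prime p \<Longrightarrow> odd p \<Longrightarrow> f p = (if QuadRes (int p) q then 1 else - 1)"
    and bound: "\<And>m n. \<bar>\<Sum>k=m..<n. f k\<bar> \<le> C"
    and s: "filterlim s sequentially sequentially" and L: "(\<lambda>n. \<Sum>k=1..s n. f k / real k) \<longlonglongrightarrow> L"
  shows "(\<lambda>N. real (D2_count q N) / real N) \<longlonglongrightarrow> 6 / pi\<^sup>2 * L"
proof -
  have "q = 2 \<or> q = - 2" using q by linarith
  \<comment> \<open>Both signs lie in the class of 2 modulo 4, as
    \<open>- 2 mod 4 = 2\<close>.\<close>
  then have q4: "q mod 4 = 2" by auto
  have cop: "\<not> int p dvd q" if "prime p" "odd p" for p
  proof
    assume "int p dvd q"
    then have "int p dvd int 2" using \<open>q = 2 \<or> q = - 2\<close> by auto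
    then have "p dvd 2" by (simp only: int_dvd_int_iff)
    then show False using that primes_dvd_imp_eq[OF that(1) two_is_prime_nat] by simp
  qed
  define P where "P = (\<lambda>N. \<Sum>b=1..N. real (sqrt_count q b))"
  have "P N = (\<Sum>k=1..N. f k * real (squarefree_count (N div k)))" for N
    unfolding P_def sum_squarefree_divisor_convolution[symmetric]
    by (intro sum.cong refl sqrt_count_eq_sum_squarefree_divisors mult one two odd_prime q4 cop) auto
  then have P: "(\<lambda>N. P N / real N) \<longlonglongrightarrow> 6 / pi\<^sup>2 * L"
    using twisted_squarefree_density[OF bound s L] by (simp only:)
  have "(\<lambda>N. real (D2_count q N) / real N - P N / real N) \<longlonglongrightarrow> 0"
  proof (rule Lim_null_comparison)
    show "\<forall>\<^sub>F N in sequentially. norm (real (D2_count q N) / real N - P N / real N) \<le> 4 / real N"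
      using D2_count_approx[OF q]
      by (intro always_eventually allI)
         (simp add: P_def divide_right_mono flip: diff_divide_distrib)
    show "(\<lambda>N. 4 / real N) \<longlonglongrightarrow> 0" by (rule lim_const_over_n)
  qed
  from tendsto_add[OF this P] show ?thesis by simp
qed

section \<open>The characters modulo 8 as one real family: \<open>e = - 1\<close> for
  \<open>chi_8_5\<close>, \<open>e = 1\<close> for \<open>chi_8_3\<close>\<close>

definition mod_8_char :: "real \<Rightarrow> nat \<Rightarrow> real" where
  "mod_8_char e n = (if n mod 8 = 1 then 1 else if n mod 8 = 3 then e
     else if n mod 8 = 5 then - 1 else if n mod 8 = 7 then - e else 0)"

lemma less_8_cases: "r < (8 :: nat) \<Longrightarrow> r = 0 \<or> r = 1 \<or> r = 2 \<or> r = 3 \<or> r = 4 \<or> r = 5 \<or> r = 6 \<or> r = 7"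
  by arith

lemma sum_lessThan_8:
  fixes h :: "nat \<Rightarrow> 'a :: comm_monoid_add"
  shows "(\<Sum>i<8. h i) = h 0 + h 1 + h 2 + h 3 + h 4 + h 5 + h 6 + h 7"
  by (simp add: eval_nat_numeral add.assoc)

lemma mod_8_char_mult:
  assumes e: "e * e = 1"
  shows "mod_8_char e (a * b) = mod_8_char e a * mod_8_char e b"
proof -
  define r s where "r = a mod 8" and "s = b mod 8"
  have rs: "r < 8" "s < 8" by (simp_all add: r_def s_def)
  have ab: "(a * b) mod 8 = (r * s) mod 8" by (simp add: r_def s_def mod_mult_eq)
  show ?thesis
    unfolding mod_8_char_def ab r_def[symmetric] s_def[symmetric]
    using less_8_cases[OF rs(1)] less_8_cases[OF rs(2)] by (elim disjE) (simp_all add: e)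
qed

lemma mod_8_char_add: "mod_8_char e (8 * k + n) = mod_8_char e n"
  by (simp add: mod_8_char_def)

lemma abs_mod_8_char_le: "\<bar>e\<bar> \<le> 1 \<Longrightarrow> \<bar>mod_8_char e n\<bar> \<le> 1"
  by (simp add: mod_8_char_def)

text \<open>A full period sums to zero, so the initial sums \<open>S\<close> are 8-periodic and
  bounded by 8; a sum over an interval is a difference of two of them.\<close>

lemma abs_sum_mod_8_char_le:
  assumes e: "\<bar>e\<bar> \<le> 1"
  shows "\<bar>\<Sum>k=m..<n. mod_8_char e k\<bar> \<le> 16"
proof -
  define S where "S = (\<lambda>n. \<Sum>k<n. mod_8_char e k)"
  have S_add: "S (n + 8) = S n" for n
  proof (induction n)
    case 0
    show ?case by (simp add: S_def sum_lessThan_8 mod_8_char_def)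
  next
    case (Suc n)
    have S_Suc: "S (Suc j) = S j + mod_8_char e j" for j by (simp add: S_def)
    have "S (Suc n + 8) = S (n + 8) + mod_8_char e (8 * 1 + n)" using S_Suc[of "n + 8"] by (simp add: add.commute)
    then show ?case by (simp only: Suc mod_8_char_add S_Suc)
  qed
  have S_le: "\<bar>S n\<bar> \<le> 8" for n
  proof (induction n rule: less_induct)
    case (less n)
    show ?case
    proof (cases "n < 8")
      case True
      have "\<bar>S n\<bar> \<le> (\<Sum>k<n. 1)"
        unfolding S_def using e by (intro sum_abs[THEN order_trans] sum_mono abs_mod_8_char_le)
      then show ?thesis using True by simp
    next
      case False
      then show ?thesis using less[of "n - 8"] S_add[of "n - 8"] by simp
    qed
  qed
  show ?thesis
  proof (cases "m \<le> n")
    case True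
    have "S n = S m + (\<Sum>k=m..<n. mod_8_char e k)"
      using True sum.atLeastLessThan_concat[of 0 m n "mod_8_char e"] by (simp add: S_def atLeast0LessThan)
    then show ?thesis using S_le[of m] S_le[of n] by linarith
  qed simp
qed

lemma sum_mod_8_block:
  fixes h :: "nat \<Rightarrow> 'a :: comm_monoid_add"
  shows "(\<Sum>n=k*8..<k*8+8. h (Suc n)) = h (8*k+1) + h (8*k+2) + h (8*k+3) + h (8*k+4) +
    h (8*k+5) + h (8*k+6) + h (8*k+7) + h (8*k+8)"
proof -
  have "(\<Sum>n=k*8..<k*8+8. h (Suc n)) = (\<Sum>i<8. h (8 * k + (i + 1)))"
    by (rule sum.reindex_bij_witness[of _ "\<lambda>i. k * 8 + i" "\<lambda>n. n - k * 8"]) (auto simp: mult.commute)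
  moreover have "0 + 1 = (1::nat)" "1 + 1 = (2::nat)" "2 + 1 = (3::nat)" "3 + 1 = (4::nat)"
    "4 + 1 = (5::nat)" "5 + 1 = (6::nat)" "6 + 1 = (7::nat)" "7 + 1 = (8::nat)" by simp_all
  ultimately show ?thesis by (simp only: sum_lessThan_8)
qed

text \<open>The series \<open>L\<close> is the character series at 1 grouped into periods of 8. As a
  sum of blocks it is the value of the continuation, by \<open>dirichlet_L_periodic\<close>; its
  partial sums are those of the ungrouped series at multiples of 8.\<close>

lemma
  fixes e L :: real
  assumes e: "e * e = 1"
    and L: "(\<lambda>k. 1 / real (8*k+1) + e / real (8*k+3) - 1 / real (8*k+5) - e / real (8*k+7)) sums L"
  shows dirichlet_L_mod_8_char: "dirichlet_L (\<lambda>n. complex_of_real (mod_8_char e n)) 1 = of_real L"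
    and sum_mod_8_char_tendsto: "(\<lambda>K. \<Sum>k=1..K*8. mod_8_char e k / real k) \<longlonglongrightarrow> L"
proof -
  have e1: "\<bar>e\<bar> \<le> 1" using e square_eq_1_iff[of e] by auto
  have vals: "mod_8_char e 1 = 1" "mod_8_char e 2 = 0" "mod_8_char e 3 = e" "mod_8_char e 4 = 0"
    "mod_8_char e 5 = - 1" "mod_8_char e 6 = 0" "mod_8_char e 7 = - e" "mod_8_char e 8 = 0"
    by (simp_all add: mod_8_char_def)
  have block: "(\<Sum>n=k*8..<k*8+8. mod_8_char e (Suc n) / real (Suc n))
      = 1 / real (8*k+1) + e / real (8*k+3) - 1 / real (8*k+5) - e / real (8*k+7)" for k
    unfolding sum_mod_8_block[of "\<lambda>n. mod_8_char e n / real n"] mod_8_char_add vals by simp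
  have "(\<Sum>k<K. \<Sum>n=k*8..<k*8+8. mod_8_char e (Suc n) / real (Suc n))
      = (\<Sum>k=1..K*8. mod_8_char e k / real k)" for K
    unfolding sum.nat_group by (simp add: sum.atLeast1_atMost_eq)
  with L show "(\<lambda>K. \<Sum>k=1..K*8. mod_8_char e k / real k) \<longlonglongrightarrow> L"
    by (simp only: sums_def block)
  have "dirichlet_L (\<lambda>n. complex_of_real (mod_8_char e n)) 1 = (\<Sum>k. \<Sum>n=k*8..<k*8+8.
      complex_of_real (mod_8_char e (Suc n)) * of_nat (Suc n) powr (- 1))"
  proof (rule dirichlet_L_periodic)
    show "complex_of_real (mod_8_char e (n + 8)) = complex_of_real (mod_8_char e n)" for n
      using mod_8_char_add[of e 1 n] by (simp add: add.commute)
    show "(\<Sum>n<8. complex_of_real (mod_8_char e (Suc n))) = 0"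
      by (simp add: sum_lessThan_8 mod_8_char_def)
    show "norm (complex_of_real (mod_8_char e n)) \<le> 1" for n
      using abs_mod_8_char_le[OF e1] by simp
  qed auto
  also have "(\<lambda>k. \<Sum>n=k*8..<k*8+8. complex_of_real (mod_8_char e (Suc n)) * of_nat (Suc n) powr (- 1))
      = (\<lambda>k. complex_of_real (1 / real (8*k+1) + e / real (8*k+3) - 1 / real (8*k+5) - e / real (8*k+7)))"
  proof
    fix k
    have "of_nat (Suc n) powr (- 1 :: complex) = of_real (1 / real (Suc n))" for n
      by (simp add: powr_minus divide_inverse del: of_nat_Suc)
    then have "(\<Sum>n=k*8..<k*8+8. complex_of_real (mod_8_char e (Suc n)) * of_nat (Suc n) powr (- 1))
        = of_real (\<Sum>n=k*8..<k*8+8. mod_8_char e (Suc n) / real (Suc n))"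
      by (simp del: of_nat_Suc)
    then show "(\<Sum>n=k*8..<k*8+8. complex_of_real (mod_8_char e (Suc n)) * of_nat (Suc n) powr (- 1))
      = complex_of_real (1 / real (8*k+1) + e / real (8*k+3) - 1 / real (8*k+5) - e / real (8*k+7))"
      by (simp only: block)
  qed
  also have "suminf \<dots> = of_real L"
    by (rule sums_unique[OF sums_of_real[OF L], symmetric])
  finally show "dirichlet_L (\<lambda>n. complex_of_real (mod_8_char e n)) 1 = of_real L" .
qed

text \<open>The density \<open>6 / pi^2 * L\<close> equals \<open>L / zeta 2\<close>. As
  \<open>L > 0\<close> it is nonzero, so dividing by it turns the limit into a quotient tending to
  1.\<close>

lemma D2_count_asymp_equiv:
  fixes e L :: real
  assumes q: "\<bar>q\<bar> = 2" and e: "e * e = 1" and L_pos: "L > 0"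
    and L: "(\<lambda>k. 1 / real (8*k+1) + e / real (8*k+3) - 1 / real (8*k+5) - e / real (8*k+7)) sums L"
    and res: "\<And>p. prime p \<Longrightarrow> odd p \<Longrightarrow> mod_8_char e p = (if QuadRes (int p) q then 1 else - 1)"
  shows "(\<lambda>N. of_nat (D2_count q N)) \<sim>[at_top] (\<lambda>N. complex_of_real L / zeta 2 * of_nat N)"
proof -
  define c where "c = 6 / pi\<^sup>2 * L"
  have e1: "\<bar>e\<bar> \<le> 1" using e square_eq_1_iff[of e] by auto
  have lim: "(\<lambda>N. real (D2_count q N) / real N) \<longlonglongrightarrow> c"
    unfolding c_def
  proof (rule D2_count_density[OF q _ _ _ res abs_sum_mod_8_char_le[OF e1]])
    \<comment> \<open>The limit \<open>L\<close> is known for whole periods, hence the truncation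
      points \<open>K * 8\<close>.\<close>
    show "filterlim (\<lambda>K. K * 8 :: nat) sequentially sequentially" by real_asymp
    show "(\<lambda>K. \<Sum>k=1..K*8. mod_8_char e k / real k) \<longlonglongrightarrow> L"
      using e L by (rule sum_mod_8_char_tendsto)
  qed (simp_all add: mod_8_char_mult[OF e], simp_all add: mod_8_char_def)
  have "c > 0" using L_pos by (simp add: c_def)
  have "(\<lambda>N. real (D2_count q N) / real N / c) \<longlonglongrightarrow> c / c"
    using \<open>c > 0\<close> by (intro tendsto_intros lim) auto
  then have "(\<lambda>N. complex_of_real (real (D2_count q N) / real N / c)) \<longlonglongrightarrow> of_real 1"
    using \<open>c > 0\<close> by (intro tendsto_of_real) simp
  moreover have "complex_of_real (real (D2_count q N) / real N / c)
      = of_nat (D2_count q N) / (complex_of_real L / zeta 2 * of_nat N)" for N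
    by (simp add: c_def zeta_2 field_simps)
  ultimately show ?thesis
    by (intro asymp_equivI') simp
qed

section \<open>Numerical values of the two densities\<close>

lemma pi_squared_bounds: "9.869604401 < pi\<^sup>2" "pi\<^sup>2 < 9.8696044011"
proof -
  have "(9.869604401::real) < 3.141592653588\<^sup>2" by (simp add: power2_eq_square)
  also have "\<dots> \<le> pi\<^sup>2" by (intro power_mono pi_approx) auto
  finally show "9.869604401 < pi\<^sup>2" .
  have "pi\<^sup>2 \<le> 3.1415926535899\<^sup>2" by (intro power_mono pi_approx) auto
  also have "\<dots> < (9.8696044011::real)" by (simp add: power2_eq_square)
  finally show "pi\<^sup>2 < 9.8696044011" .
qed

lemma abs_diff_leI:
  fixes x y :: real
  assumes "x \<le> u" "l \<le> x" "y - d \<le> l" "u \<le> y + d"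
  shows "\<bar>x - y\<bar> \<le> d"
  using assms by linarith

lemma density_plus_2_approx: "\<bar>ln (1 + sqrt 2) / sqrt 2 / (pi\<^sup>2 / 6) - 0.37888\<bar> \<le> 0.000005"
proof -
  \<comment> \<open>The density is about 0.3788755, less than 0.000001 above the lower end of the
    interval; this dictates the precision of the bound on the logarithm.\<close>
  have "(0.378875::real) \<le> 0.881373 / 1.41421357 / (9.8696044011 / 6)" by simp
  also have "\<dots> \<le> ln (1 + sqrt 2) / sqrt 2 / (pi\<^sup>2 / 6)"
    using ln_one_plus_sqrt_2_bounds(1) pi_squared_bounds(2) sqrt_2_bounds
    by (intro frac_le) auto
  finally have lower: "0.378875 \<le> ln (1 + sqrt 2) / sqrt 2 / (pi\<^sup>2 / 6)" .
  have "ln (1 + sqrt 2) / sqrt 2 / (pi\<^sup>2 / 6) \<le> 0.881374 / 1.41421356 / (9.869604401 / 6)"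
    using ln_one_plus_sqrt_2_bounds(2) pi_squared_bounds(1) sqrt_2_bounds
    by (intro frac_le) auto
  also have "\<dots> \<le> (0.378885::real)" by simp
  finally show ?thesis using lower by (rule abs_diff_leI) simp_all
qed

lemma density_minus_2_approx: "\<bar>pi / (2 * sqrt 2) / (pi\<^sup>2 / 6) - 0.67524\<bar> \<le> 0.000005"
proof -
  have "(0.675235::real) \<le> 3.141592653588 / (2 * 1.41421357) / (9.8696044011 / 6)" by simp
  also have "\<dots> \<le> pi / (2 * sqrt 2) / (pi\<^sup>2 / 6)"
    using pi_approx(1) pi_squared_bounds(2) sqrt_2_bounds by (intro frac_le) auto
  finally have lower: "0.675235 \<le> pi / (2 * sqrt 2) / (pi\<^sup>2 / 6)" .
  have "pi / (2 * sqrt 2) / (pi\<^sup>2 / 6) \<le> 3.1415926535899 / (2 * 1.41421356) / (9.869604401 / 6)"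
    using pi_approx(2) pi_squared_bounds(1) sqrt_2_bounds by (intro frac_le) auto
  also have "\<dots> \<le> (0.675245::real)" by simp
  finally show ?thesis using lower by (rule abs_diff_leI) simp_all
qed

lemma odd_mod_8_cases:
  assumes "odd (p :: nat)"
  shows "p mod 8 = 1 \<or> p mod 8 = 3 \<or> p mod 8 = 5 \<or> p mod 8 = 7"
  using assms by presburger

lemma chi_8_5_eq: "chi_8_5 = (\<lambda>n. complex_of_real (mod_8_char (- 1) n))"
proof
  fix n :: nat
  define r where "r = n mod 8"
  have r: "r < 8" "even n \<longleftrightarrow> even r" unfolding r_def by presburger+
  then show "chi_8_5 n = complex_of_real (mod_8_char (- 1) n)"
    unfolding chi_8_5_def mod_8_char_def r_def[symmetric] r(2)
    using less_8_cases[OF r(1)] by (elim disjE) simp_all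
qed

lemma chi_8_3_eq: "chi_8_3 = (\<lambda>n. complex_of_real (mod_8_char 1 n))"
proof
  fix n :: nat
  define r where "r = n mod 8"
  have r: "r < 8" "even n \<longleftrightarrow> even r" unfolding r_def by presburger+
  then show "chi_8_3 n = complex_of_real (mod_8_char 1 n)"
    unfolding chi_8_3_def mod_8_char_def r_def[symmetric] r(2)
    using less_8_cases[OF r(1)] by (elim disjE) simp_all
qed

theorem theorem1:
  shows "((\<lambda>N. of_nat (D2_count 2 N)) \<sim>[at_top]
            (\<lambda>N. dirichlet_L chi_8_5 1 / zeta 2 * of_nat N)) \<and>
         norm (dirichlet_L chi_8_5 1 / zeta 2 - 0.37888) \<le> 0.000005 \<and>
         ((\<lambda>N. of_nat (D2_count (-2) N)) \<sim>[at_top]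
            (\<lambda>N. dirichlet_L chi_8_3 1 / zeta 2 * of_nat N)) \<and>
         norm (dirichlet_L chi_8_3 1 / zeta 2 - 0.67524) \<le> 0.000005"
proof -
  have L5: "dirichlet_L chi_8_5 1 = of_real (ln (1 + sqrt 2) / sqrt 2)"
    unfolding chi_8_5_eq by (rule dirichlet_L_mod_8_char[OF _ mod_8_series_minus_sums]) simp
  have L3: "dirichlet_L chi_8_3 1 = of_real (pi / (2 * sqrt 2))"
    unfolding chi_8_3_eq by (rule dirichlet_L_mod_8_char[OF _ mod_8_series_plus_sums]) simp
  have norm_eq: "norm (complex_of_real x / zeta 2 - of_real y) = \<bar>x / (pi\<^sup>2 / 6) - y\<bar>" for x y
    unfolding zeta_2 of_real_divide[symmetric] of_real_diff[symmetric] by (rule norm_of_real)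
  have "(\<lambda>N. of_nat (D2_count 2 N)) \<sim>[at_top] (\<lambda>N. dirichlet_L chi_8_5 1 / zeta 2 * of_nat N)"
    unfolding L5
  proof (rule D2_count_asymp_equiv[OF _ _ _ mod_8_series_minus_sums])
    show "mod_8_char (- 1) p = (if QuadRes (int p) 2 then 1 else - 1)" if "prime p" "odd p" for p
      using odd_mod_8_cases[OF that(2)] QuadRes_two_iff[OF that] by (auto simp: mod_8_char_def)
  qed (use ln_one_plus_sqrt_2_bounds(1) in auto)
  moreover have "(\<lambda>N. of_nat (D2_count (- 2) N)) \<sim>[at_top] (\<lambda>N. dirichlet_L chi_8_3 1 / zeta 2 * of_nat N)"
    unfolding L3
  proof (rule D2_count_asymp_equiv[OF _ _ _ mod_8_series_plus_sums])
    show "mod_8_char 1 p = (if QuadRes (int p) (- 2) then 1 else - 1)" if "prime p" "odd p" for p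
      using odd_mod_8_cases[OF that(2)] QuadRes_minus_two_iff[OF that] by (auto simp: mod_8_char_def)
  qed auto
  moreover have "norm (dirichlet_L chi_8_5 1 / zeta 2 - 0.37888) \<le> 0.000005"
    using norm_eq[of "ln (1 + sqrt 2) / sqrt 2" "0.37888"] density_plus_2_approx by (simp add: L5)
  moreover have "norm (dirichlet_L chi_8_3 1 / zeta 2 - 0.67524) \<le> 0.000005"
    using norm_eq[of "pi / (2 * sqrt 2)" "0.67524"] density_minus_2_approx by (simp add: L3)
  ultimately show ?thesis by blast
qed

end
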